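(* Let $\lambda := \max_{x>0} \frac{1-e^{-x}}{\sqrt{x}} = 0.63817\ldots$. For every $\varepsilon, c \in (0,1)$ there exists $d_0$ such that for every integer $d \geq d_0$ and for every integer $t \geq d+1$, there is a graph $G$ with average degree at least $(1-\varepsilon)\lambda\, t\sqrt{\ln d}$ such that if $H \in \mathcal{G}(t, td/2)$ then $\mathbb{P}(H \text{ is a minor of } G) < c^t$, and in particular $\mathbb{P}\big(f(H) \geq (1-\varepsilon)\lambda\, t\sqrt{\ln d}\big) > 1 - c^t$.
   Context: A graph $H$ is a minor of a graph $G$ if a graph isomorphic to $H$ can be obtained from a subgraph of $G$ by contracting edges. For a graph $H$, $f(H)$ denotes the infimum of all real numbers $d$ such that every graph with average degree at least $d$ contains $H$ as a minor. $\mathcal{G}(t,m)$ denotes the uniform probability space of random graphs with vertex set $\{1,2,\dots,t\}$ and exactly $m$ edges; thus $\mathcal{G}(t,td/2)$ is the space of random graphs with $t$ vertices and average degree $d$. *)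

theory Defs
  imports "HOL-Probability.Probability"
begin

type_synonym 'a sgraph = "'a set \<times> 'a set set"

abbreviation verts :: "'a sgraph \<Rightarrow> 'a set" where "verts \<equiv> fst"
abbreviation edges :: "'a sgraph \<Rightarrow> 'a set set" where "edges \<equiv> snd"

definition simple_graph :: "'a sgraph \<Rightarrow> bool" where
  "simple_graph G \<longleftrightarrow> finite (verts G) \<and> verts G \<noteq> {} \<and>
     (\<forall>e\<in>edges G. e \<subseteq> verts G \<and> card e = 2)"

definition vdegree :: "'a sgraph \<Rightarrow> 'a \<Rightarrow> nat" where
  "vdegree G v = card {e \<in> edges G. v \<in> e}"

definition average_degree :: "'a sgraph \<Rightarrow> real" where
  "average_degree G = (\<Sum>v\<in>verts G. real (vdegree G v)) / real (card (verts G))"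

definition is_subgraph :: "'a sgraph \<Rightarrow> 'a sgraph \<Rightarrow> bool" where
  "is_subgraph S G \<longleftrightarrow> simple_graph S \<and> verts S \<subseteq> verts G \<and> edges S \<subseteq> edges G"

definition isomorphic :: "'a sgraph \<Rightarrow> 'b sgraph \<Rightarrow> bool" where
  "isomorphic G H \<longleftrightarrow>
     (\<exists>\<phi>. bij_betw \<phi> (verts G) (verts H) \<and> edges H = (\<lambda>e. \<phi> ` e) ` edges G)"

text \<open>Contracting the edge \<open>{u, v}\<close>: the merged vertex keeps the name \<open>u\<close>. Loops are
  discarded, and parallel edges are identified because edges form a set.\<close>

definition contract_edge :: "'a sgraph \<Rightarrow> 'a \<Rightarrow> 'a \<Rightarrow> 'a sgraph" where
  "contract_edge G u v =
     (verts G - {v},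
      {e \<in> edges G. v \<notin> e} \<union> {{u, w} | w. {v, w} \<in> edges G \<and> w \<noteq> u})"

definition contraction_step :: "'a sgraph \<Rightarrow> 'a sgraph \<Rightarrow> bool" where
  "contraction_step G G' \<longleftrightarrow> (\<exists>u v. {u, v} \<in> edges G \<and> G' = contract_edge G u v)"

definition is_minor :: "'b sgraph \<Rightarrow> 'a sgraph \<Rightarrow> bool" where
  "is_minor H G \<longleftrightarrow>
     (\<exists>S K. is_subgraph S G \<and> contraction_step\<^sup>*\<^sup>* S K \<and> isomorphic K H)"

text \<open>Every finite graph is isomorphic to one with vertices in \<open>nat\<close>, so nothing is lost by letting
  \<open>G\<close> range over graphs of that vertex type.\<close>

definition minor_threshold :: "'a sgraph \<Rightarrow> real" where
  "minor_threshold H =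
     Inf {d. \<forall>G :: nat sgraph. simple_graph G \<and> average_degree G \<ge> d \<longrightarrow> is_minor H G}"

definition graphs_with_edges :: "nat \<Rightarrow> nat \<Rightarrow> nat sgraph set" where
  "graphs_with_edges t m = {H. simple_graph H \<and> verts H = {1..t} \<and> card (edges H) = m}"

text \<open>\<open>pmf_of_set\<close> is the uniform distribution only on a nonempty set, that is, for
  \<open>m \<le> t choose 2\<close> and \<open>t \<ge> 1\<close>.\<close>

definition random_graph :: "nat \<Rightarrow> nat \<Rightarrow> nat sgraph pmf" where
  "random_graph t m = pmf_of_set (graphs_with_edges t m)"

definition lambda_const :: real where
  "lambda_const = (GREATEST y. \<exists>x>0. y = (1 - exp (- x)) / sqrt x)"

text \<open>\<open>GREATEST\<close> is the maximum only if one exists; the lemmas below show that it is attained, and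
  locate its value.\<close>

lemma lambda_profile_small:
  assumes "0 < x" shows "(1 - exp (- x)) / sqrt x \<le> sqrt x"
proof -
  have "1 - exp (-x) \<le> x" using exp_ge_add_one_self[of "-x"] by linarith
  then show ?thesis using assms by (simp add: divide_le_eq)
qed

lemma lambda_profile_large:
  assumes "0 < x" shows "(1 - exp (- x)) / sqrt x \<le> 1 / sqrt x"
  using assms by (simp add: divide_right_mono)

lemma lambda_max_attained: "\<exists>x>0. \<forall>y>0. (1 - exp (- y)) / sqrt y \<le> (1 - exp (- x)) / sqrt (x::real)"
proof -
  let ?f = "\<lambda>x::real. (1 - exp (- x)) / sqrt x"
  have "continuous_on {1/4..4} ?f" by (intro continuous_intros) auto
  then obtain x where x: "x \<in> {1/4..4}" "\<forall>y\<in>{1/4..4}. ?f y \<le> ?f x"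
    using continuous_attains_sup[of "{1/4..4::real}" ?f] by auto
  have "exp (1::real) \<ge> 2" using exp_ge_add_one_self[of 1] by simp
  then have "?f 1 \<ge> 1/2" by (simp add: exp_minus field_simps)
  moreover have "?f 1 \<le> ?f x" using x(2) by (rule bspec) auto
  ultimately have half: "?f x \<ge> 1/2" by linarith
  have "?f y \<le> ?f x" if "y > 0" for y
  proof -
    consider "y < 1/4" | "y \<in> {1/4..4}" | "y > 4" by fastforce
    then show ?thesis
    proof cases
      case 1
      then have "sqrt y \<le> 1/2" by (intro real_le_lsqrt) (auto simp: power2_eq_square)
      then show ?thesis using lambda_profile_small[OF that] half by linarith
    next
      case 2 then show ?thesis using x(2) by blast
    next
      case 3
      then have "sqrt y \<ge> 2" by (intro real_le_rsqrt) (auto simp: power2_eq_square)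
      then have "1 / sqrt y \<le> 1/2" using 3 by (simp add: divide_le_eq)
      then show ?thesis using lambda_profile_large[OF that] half by linarith
    qed
  qed
  then show ?thesis using x(1) by (intro exI[of _ x]) auto
qed

lemma lambda_const_eq:
  fixes x :: real
  assumes "0 < x"
    and "\<And>y. 0 < y \<Longrightarrow> (1 - exp (- y)) / sqrt y \<le> (1 - exp (- x)) / sqrt x"
  shows "lambda_const = (1 - exp (- x)) / sqrt x"
  unfolding lambda_const_def using assms by (intro Greatest_equality) auto

lemma exp_convex_chord:
  fixes a x :: real
  assumes "0 < a" "a \<le> x"
  shows "exp a \<le> 1 + a / x * (exp x - 1)"
proof -
  have "exp ((1 - a / x) *\<^sub>R 0 + (a / x) *\<^sub>R x) \<le> (1 - a / x) * exp 0 + (a / x) * exp x"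
    using assms by (intro convex_onD[OF exp_convex]) auto
  then show ?thesis using assms by (simp add: algebra_simps)
qed

lemma lambda_const_bounds: "0.63817 \<le> lambda_const" "lambda_const < 0.63818"
proof -
  let ?f = "\<lambda>x::real. (1 - exp (- x)) / sqrt x"
  obtain x :: real where x: "x > 0" and max: "\<And>y. y > 0 \<Longrightarrow> ?f y \<le> ?f x"
    using lambda_max_attained by blast
  have "(?f has_real_derivative
      (exp (- x) * sqrt x - (1 - exp (- x)) * (inverse (sqrt x) / 2)) / (sqrt x * sqrt x)) (at x)"
    using x by (auto intro!: derivative_eq_intros)
  then have "(exp (- x) * sqrt x - (1 - exp (- x)) * (inverse (sqrt x) / 2)) / (sqrt x * sqrt x) = 0"
    by (rule DERIV_local_max[where d = x]) (use x max in \<open>auto simp: abs_less_iff\<close>)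
  then have "exp (- x) * sqrt x = (1 - exp (- x)) * (inverse (sqrt x) / 2)"
    using x by simp
  then have "(exp (- x) * sqrt x) * sqrt x =
      ((1 - exp (- x)) * (inverse (sqrt x) / 2)) * sqrt x"
    by (rule arg_cong)
  then have "exp (- x) * (2 * x) = 1 - exp (- x)" using x by (simp add: mult.assoc)
  then have "exp (- x) * (1 + 2 * x) = 1" using x by (simp add: algebra_simps)
  then have ex: "exp x = 1 + 2 * x" by (simp add: exp_minus field_simps)
  have lower: "1.2564 < x"
  proof (rule ccontr)
    let ?a = "1.2564 :: real"
    assume "\<not> ?a < x"
    then have chord: "exp x \<le> 1 + x / ?a * (exp ?a - 1)"
      using exp_convex_chord[of x ?a] x by simp
    obtain s where s: "\<bar>s\<bar> \<le> \<bar>?a\<bar>"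
      "exp ?a = (\<Sum>m<10. ?a ^ m / fact m) + exp s / fact 10 * ?a ^ 10"
      using Maclaurin_exp_le[of ?a 10] by blast
    have "exp s \<le> exp (1 + 1)" using s(1) by simp
    also have "\<dots> \<le> 3 * 3" unfolding exp_add using exp_le by (intro mult_mono) auto
    finally have "exp s \<le> 9" by simp
    then have "exp ?a < 1 + 2 * ?a" using s(2) by (simp add: eval_nat_numeral fact_numeral)
    then have "x / ?a * (exp ?a - 1) < x / ?a * (2 * ?a)"
      using x by (intro mult_strict_left_mono) auto
    then show False using chord ex by simp
  qed
  have upper: "x < 1.25645"
  proof (rule ccontr)
    let ?b = "1.25645 :: real"
    assume "\<not> x < ?b"
    then have "exp ?b \<le> 1 + ?b / x * (exp x - 1)"
      using exp_convex_chord[of ?b x] by simp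
    then have chord: "exp ?b \<le> 1 + 2 * ?b" using ex x by simp
    obtain s where s: "exp ?b = (\<Sum>m<10. ?b ^ m / fact m) + exp s / fact 10 * ?b ^ 10"
      using Maclaurin_exp_le[of ?b 10] by blast
    have "0 \<le> exp s / fact 10 * ?b ^ 10" by simp
    moreover have "1 + 2 * ?b < (\<Sum>m<10. ?b ^ m / fact m)"
      by (simp add: eval_nat_numeral fact_numeral)
    ultimately show False using s chord by linarith
  qed
  have "lambda_const = ?f x" by (rule lambda_const_eq[OF x max])
  also have "exp (- x) = 1 / (1 + 2 * x)" using ex by (simp add: exp_minus inverse_eq_divide)
  also have "1 - 1 / (1 + 2 * x) = 2 * x / (1 + 2 * x)" using x by (simp add: field_simps)
  also have "\<dots> / sqrt x = 2 * (x / sqrt x) / (1 + 2 * x)" by simp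
  also have "x / sqrt x = sqrt x" using x by (simp add: real_div_sqrt)
  finally have eq: "lambda_const = 2 * sqrt x / (1 + 2 * x)" .
  define s where "s = sqrt x"
  have "1.12089 < s"
    unfolding s_def using lower by (intro real_less_rsqrt) (simp add: power2_eq_square)
  moreover have "s < 1.120915"
    unfolding s_def using x upper by (intro real_less_lsqrt) (simp_all add: power2_eq_square)
  moreover have "s * s \<le> 2.240915 * s - 1.2554248"
  proof -
    have "0 \<le> (s - 1.12) * (1.120915 - s)"
      using calculation by (intro mult_nonneg_nonneg) simp_all
    also have "\<dots> = 2.240915 * s - 1.2554248 - s * s"
      by (simp add: field_simps)
    finally show ?thesis by simp
  qed
  moreover have "2.24178 * s - 1.2563943921 \<le> s * s"
  proof -
    have "0 \<le> (s - 1.12089) * (s - 1.12089)" by simp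
    also have "\<dots> = s * s - (2.24178 * s - 1.2563943921)"
      by (simp add: field_simps)
    finally show ?thesis by simp
  qed
  ultimately have "0.63817 * (1 + 2 * (s * s)) \<le> 2 * s" "2 * s < 0.63818 * (1 + 2 * (s * s))"
    by simp_all
  moreover have "s * s = x" unfolding s_def using x by simp
  ultimately show "0.63817 \<le> lambda_const" "lambda_const < 0.63818"
    unfolding eq s_def[symmetric] using x by (simp_all add: pos_le_divide_eq pos_divide_less_eq)
qed

end

theory Submission
  imports Defs "HOL-Real_Asymp.Real_Asymp"
begin

text \<open>
  Let \<open>x\<close> be the maximiser in the definition of \<open>\<lambda>\<close> and take a random graph with edge probability
  \<open>p = 1 - exp (- x)\<close> on polynomially (in \<open>d\<close>) many vertices. A minor on \<open>t\<close> vertices in a host with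
  about \<open>t * S\<close> vertices, \<open>S = sqrt (ln d / x)\<close>, has many branch sets of size at most
  \<open>s = (1 - \<delta>) * S\<close>, and two disjoint sets of that size are non-adjacent with probability at least
  \<open>exp (- x * s * s) \<ge> d powr (- (1 - \<delta>)\<^sup>2)\<close>. Hence some graph with nearly the expected number of edges
  has no \<open>r\<close> disjoint, pairwise adjacent sets of size at most \<open>s\<close>, where \<open>r\<close> is about
  \<open>d powr (1 - \<delta>)\<close>; by a weak form of Turan's theorem every system of \<open>t\<close> branch sets then has
  at least of order \<open>t\<^sup>2 / r\<close> non-adjacent pairs. A random \<open>H\<close> with average degree \<open>d\<close> avoids all of
  these with probability at most \<open>exp (- const * t * d powr \<delta>)\<close>, which beats the number of possible
  systems. For \<open>t\<close> large compared with \<open>d\<close> this number would be too big in a random graph on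
  \<open>t * S\<close> vertices; blowing up a base graph whose size depends on \<open>d\<close> only keeps it at
  \<open>exp (O (t * S * ln d))\<close>, since only the traces of the branch sets on the base graph matter.
\<close>

section \<open>Subgraphs and contractions\<close>

lemma simple_graph_edgeD:
  assumes "simple_graph G" "e \<in> edges G"
  shows "e \<subseteq> verts G" "card e = 2" "finite e"
  using assms unfolding simple_graph_def by (auto intro: card_ge_0_finite)

lemma simple_graph_pairD:
  assumes "simple_graph G" "{u, v} \<in> edges G"
  shows "u \<in> verts G" "v \<in> verts G" "u \<noteq> v"
  using simple_graph_edgeD[OF assms] by (auto simp: card_2_iff)

lemma finite_verts: "simple_graph G \<Longrightarrow> finite (verts G)"
  by (simp add: simple_graph_def)

lemma finite_edges: "simple_graph G \<Longrightarrow> finite (edges G)"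
  unfolding simple_graph_def by (meson PowI finite_Pow_iff finite_subset subsetI)

text \<open>Lets edges be counted as ordered pairs, which suits symmetric relations and bijections
  on coordinates better than doubletons.\<close>

lemma card_ordered_pairs:
  assumes "finite B" "\<And>e. e \<in> B \<Longrightarrow> card e = 2"
  shows "card {(u, v). {u, v} \<in> B} = 2 * card B"
proof -
  have two: "card {(u, v). {u, v} = e} = 2" "finite {(u, v). {u, v} = e}" if e: "e \<in> B" for e
  proof -
    obtain a b where ab: "e = {a, b}" "a \<noteq> b" using assms(2)[OF e] by (auto simp: card_2_iff)
    have "{(u, v). {u, v} = e} = {(a, b), (b, a)}"
      unfolding ab(1) doubleton_eq_iff by auto
    then show "card {(u, v). {u, v} = e} = 2" "finite {(u, v). {u, v} = e}" using ab(2) by simp_all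
  qed
  have "{(u, v). {u, v} \<in> B} = (\<Union>e\<in>B. {(u, v). {u, v} = e})"
    by auto
  also have "card \<dots> = (\<Sum>e\<in>B. card {(u, v). {u, v} = e})"
    using assms(1) two(2) by (intro card_UN_disjoint) blast+
  also have "\<dots> = (\<Sum>e\<in>B. 2)" using two(1) by (rule sum.cong[OF refl])
  finally show ?thesis by simp
qed

lemma sum_vdegree:
  assumes "simple_graph G"
  shows "(\<Sum>v\<in>verts G. vdegree G v) = 2 * card (edges G)"
proof -
  have "(\<Sum>v\<in>verts G. vdegree G v) = (\<Sum>v\<in>verts G. \<Sum>e | e \<in> edges G \<and> v \<in> e. 1)"
    by (simp add: vdegree_def)
  also have "\<dots> = (\<Sum>e\<in>edges G. \<Sum>v | v \<in> verts G \<and> v \<in> e. 1)"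
    by (rule sum.swap_restrict) (use assms in \<open>auto simp: finite_verts finite_edges\<close>)
  also have "\<dots> = (\<Sum>e\<in>edges G. 2)"
  proof (rule sum.cong)
    fix e assume e: "e \<in> edges G"
    then have "{v \<in> verts G. v \<in> e} = e" using simple_graph_edgeD[OF assms e] by auto
    then show "(\<Sum>v | v \<in> verts G \<and> v \<in> e. 1) = (2::nat)"
      using simple_graph_edgeD[OF assms e] by simp
  qed simp
  finally show ?thesis by simp
qed

lemma average_degree_eq:
  assumes "simple_graph G"
  shows "average_degree G = 2 * real (card (edges G)) / real (card (verts G))"
  unfolding average_degree_def of_nat_sum[symmetric] sum_vdegree[OF assms] by simp

lemma is_subgraph_refl: "simple_graph G \<Longrightarrow> is_subgraph G G"
  by (simp add: is_subgraph_def)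

lemma is_subgraph_trans: "is_subgraph S T \<Longrightarrow> is_subgraph T G \<Longrightarrow> is_subgraph S G"
  by (auto simp: is_subgraph_def)

lemma simple_graph_contract_edge:
  assumes "simple_graph G" "{u, v} \<in> edges G"
  shows "simple_graph (contract_edge G u v)"
proof -
  note uv = simple_graph_pairD[OF assms]
  have "e \<subseteq> verts G - {v} \<and> card e = 2" if e: "e \<in> edges (contract_edge G u v)" for e
  proof -
    consider "e \<in> edges G" "v \<notin> e" | w where "e = {u, w}" "{v, w} \<in> edges G" "w \<noteq> u"
      using e by (auto simp: contract_edge_def)
    then show ?thesis
    proof cases
      case 1
      then show ?thesis using simple_graph_edgeD[OF assms(1)] by blast
    next
      case 2
      then show ?thesis using simple_graph_pairD[OF assms(1) 2(2)] uv by auto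
    qed
  qed
  then show ?thesis
    using uv finite_verts[OF assms(1)] by (auto simp: simple_graph_def contract_edge_def)
qed

lemma simple_graph_contraction_step:
  "simple_graph G \<Longrightarrow> contraction_step G K \<Longrightarrow> simple_graph K"
  by (auto simp: contraction_step_def simple_graph_contract_edge)

lemma simple_graph_contractions:
  assumes "contraction_step\<^sup>*\<^sup>* G K" "simple_graph G"
  shows "simple_graph K"
  using assms by induction (auto intro: simple_graph_contraction_step)

text \<open>Undoing a contraction below a subgraph. If \<open>T\<close> avoids the merged vertex, it
  already lies in \<open>G\<close>. Otherwise \<open>v\<close> and the edge \<open>{u, v}\<close>
  are restored, and an edge \<open>{u, w}\<close> of \<open>T\<close> is lifted to whichever of
  \<open>{u, w}\<close> and \<open>{v, w}\<close> lie in \<open>G\<close>.\<close>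

lemma subgraph_contract_edge_lift:
  assumes G: "simple_graph G" and uv: "{u, v} \<in> edges G"
    and T: "is_subgraph T (contract_edge G u v)"
  shows "\<exists>T'. is_subgraph T' G \<and> contraction_step\<^sup>*\<^sup>* T' T"
proof (cases "u \<in> verts T")
  case False
  have "edges T \<subseteq> edges G"
  proof
    fix e assume e: "e \<in> edges T"
    then have "u \<notin> e" using False T by (auto simp: is_subgraph_def simple_graph_def)
    then show "e \<in> edges G" using e T by (auto simp: is_subgraph_def contract_edge_def)
  qed
  then have "is_subgraph T G" using T by (auto simp: is_subgraph_def contract_edge_def)
  then show ?thesis by blast
next
  case True
  note uvD = simple_graph_pairD[OF G uv]
  have T1: "simple_graph T" "verts T \<subseteq> verts G - {v}"
    and T2: "\<And>e. e \<in> edges T \<Longrightarrow> e \<in> edges G \<and> v \<notin> e \<or> (\<exists>w. e = {u, w} \<and> {v, w} \<in> edges G \<and> w \<noteq> u)"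
    using T by (auto simp: is_subgraph_def contract_edge_def)
  define T' where "T' = (insert v (verts T),
    insert {u, v} ((edges T \<inter> edges G) \<union> {{v, w} | w. {u, w} \<in> edges T \<and> {v, w} \<in> edges G}))"
  have edgeT: "e \<subseteq> verts T" "card e = 2" "v \<notin> e" if "e \<in> edges T" for e
    using simple_graph_edgeD[OF T1(1) that] T1(2) by auto
  have "simple_graph T'"
    unfolding simple_graph_def
  proof (intro conjI ballI)
    show "finite (verts T')" using finite_verts[OF T1(1)] by (simp add: T'_def)
    show "verts T' \<noteq> {}" by (simp add: T'_def)
    fix e assume "e \<in> edges T'"
    then consider "e = {u, v}" | "e \<in> edges T" | w where "e = {v, w}" "{u, w} \<in> edges T"
      by (auto simp: T'_def)
    then have "e \<subseteq> insert v (verts T) \<and> card e = 2"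
    proof cases
      case 1 then show ?thesis using True uvD by auto
    next
      case 2 then show ?thesis using edgeT by auto
    next
      case 3 then show ?thesis using edgeT[OF 3(2)] by auto
    qed
    then show "e \<subseteq> verts T'" "card e = 2" by (auto simp: T'_def)
  qed
  moreover have "verts T' \<subseteq> verts G" "edges T' \<subseteq> edges G"
    using T1(2) uvD uv by (auto simp: T'_def)
  ultimately have "is_subgraph T' G" by (simp add: is_subgraph_def)
  moreover have "contract_edge T' u v = T"
  proof (rule prod_eqI)
    show "verts (contract_edge T' u v) = verts T"
      using T1(2) by (auto simp: T'_def contract_edge_def)
    show "edges (contract_edge T' u v) = edges T"
    proof (rule set_eqI)
      fix e
      show "e \<in> edges (contract_edge T' u v) \<longleftrightarrow> e \<in> edges T"
      proof
        assume "e \<in> edges (contract_edge T' u v)"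
        then consider "e \<in> edges T'" "v \<notin> e" | w where "e = {u, w}" "{v, w} \<in> edges T'" "w \<noteq> u"
          by (auto simp: contract_edge_def)
        then show "e \<in> edges T"
        proof cases
          case 1 then show ?thesis by (auto simp: T'_def)
        next
          case 2
          then have "{v, w} \<in> edges T \<or> (\<exists>w'. {v, w} = {v, w'} \<and> {u, w'} \<in> edges T)"
            using uvD by (auto simp: T'_def doubleton_eq_iff)
          then show ?thesis
            using 2 edgeT(3) by (auto simp: doubleton_eq_iff)
        qed
      next
        assume e: "e \<in> edges T"
        show "e \<in> edges (contract_edge T' u v)"
        proof (cases "e \<in> edges G")
          case True
          then show ?thesis using e edgeT(3)[OF e] by (auto simp: contract_edge_def T'_def)
        next
          case False
          then obtain w where "e = {u, w}" "{v, w} \<in> edges G" "w \<noteq> u" using T2[OF e] by auto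
          then show ?thesis using e by (auto simp: contract_edge_def T'_def)
        qed
      qed
    qed
  qed
  then have "contraction_step T' T"
    unfolding contraction_step_def by (intro exI[of _ u] exI[of _ v]) (auto simp: T'_def)
  ultimately show ?thesis by blast
qed

lemma subgraph_contractions_lift:
  assumes "contraction_step\<^sup>*\<^sup>* G K" "simple_graph G" "is_subgraph T K"
  shows "\<exists>T'. is_subgraph T' G \<and> contraction_step\<^sup>*\<^sup>* T' T"
  using assms
proof (induction arbitrary: T)
  case base
  then show ?case by blast
next
  case (step K K')
  have "simple_graph K" using step simple_graph_contractions by blast
  moreover obtain u v where "{u, v} \<in> edges K" "K' = contract_edge K u v"
    using step.hyps by (auto simp: contraction_step_def)
  ultimately obtain T1 where "is_subgraph T1 K" "contraction_step\<^sup>*\<^sup>* T1 T"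
    using subgraph_contract_edge_lift step.prems by metis
  moreover obtain T' where "is_subgraph T' G" "contraction_step\<^sup>*\<^sup>* T' T1"
    using step.IH[OF step.prems(1)] calculation(1) by blast
  ultimately show ?case by (meson rtranclp_trans)
qed

section \<open>Minors taken inside the host, without the isomorphism\<close>

definition subcontraction :: "'a sgraph \<Rightarrow> 'a sgraph \<Rightarrow> bool" where
  "subcontraction K G \<longleftrightarrow> (\<exists>S. is_subgraph S G \<and> contraction_step\<^sup>*\<^sup>* S K)"

lemma simple_graph_subcontraction: "subcontraction K G \<Longrightarrow> simple_graph K"
  unfolding subcontraction_def is_subgraph_def using simple_graph_contractions by blast

lemma subcontraction_subgraph: "is_subgraph S G \<Longrightarrow> subcontraction S G"
  unfolding subcontraction_def by blast

lemma subcontraction_contract_edge: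
  "simple_graph G \<Longrightarrow> {u, v} \<in> edges G \<Longrightarrow> subcontraction (contract_edge G u v) G"
  unfolding subcontraction_def contraction_step_def using is_subgraph_refl by blast

text \<open>A subgraph taken after contractions can be pulled back before them, so alternating the
  two operations yields nothing new. Mader's argument alternates them.\<close>

lemma subcontraction_trans:
  assumes "subcontraction L K" "subcontraction K G"
  shows "subcontraction L G"
proof -
  obtain S where S: "is_subgraph S G" "contraction_step\<^sup>*\<^sup>* S K"
    using assms(2) by (auto simp: subcontraction_def)
  obtain T where T: "is_subgraph T K" "contraction_step\<^sup>*\<^sup>* T L"
    using assms(1) by (auto simp: subcontraction_def)
  obtain T' where "is_subgraph T' S" "contraction_step\<^sup>*\<^sup>* T' T"
    using subgraph_contractions_lift[OF S(2) _ T(1)] S(1) by (auto simp: is_subgraph_def)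
  then show ?thesis
    unfolding subcontraction_def using S(1) T(2) by (meson is_subgraph_trans rtranclp_trans)
qed

text \<open>The edge \<open>{u, v}\<close> disappears, and for each common neighbour two edges merge
  into one; every other edge at \<open>v\<close> survives with \<open>v\<close> renamed to
  \<open>u\<close>.\<close>

lemma card_edges_contract_edge:
  assumes G: "simple_graph G" and uv: "{u, v} \<in> edges G"
  shows "card (edges G) \<le> card (edges (contract_edge G u v)) + 1
    + card {w. {u, w} \<in> edges G \<and> {v, w} \<in> edges G}"
proof -
  note uvD = simple_graph_pairD[OF G uv]
  let ?C = "{w. {u, w} \<in> edges G \<and> {v, w} \<in> edges G}"
  let ?D = "{w. {v, w} \<in> edges G \<and> w \<noteq> u \<and> {u, w} \<notin> edges G}"
  let ?E = "{e \<in> edges G. v \<notin> e}"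
  have fin: "finite (edges G)" "finite ?C" "finite ?D" "finite ?E"
    using finite_edges[OF G] finite_subset[OF _ finite_verts[OF G]] simple_graph_pairD[OF G]
    by (auto intro!: finite_subset[OF _ finite_verts[OF G]])
  have "edges G \<subseteq> ?E \<union> {{u, v}} \<union> (\<lambda>w. {v, w}) ` ?C \<union> (\<lambda>w. {v, w}) ` ?D"
  proof
    fix e assume e: "e \<in> edges G"
    show "e \<in> ?E \<union> {{u, v}} \<union> (\<lambda>w. {v, w}) ` ?C \<union> (\<lambda>w. {v, w}) ` ?D"
    proof (cases "v \<in> e")
      case True
      then obtain w where "e = {v, w}"
        using simple_graph_edgeD(2)[OF G e] by (auto simp: card_2_iff)
      then show ?thesis using e by (cases "w = u"; cases "{u, w} \<in> edges G") auto
    qed (use e in auto)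
  qed
  then have "card (edges G) \<le> card (?E \<union> {{u, v}} \<union> (\<lambda>w. {v, w}) ` ?C \<union> (\<lambda>w. {v, w}) ` ?D)"
    using fin by (intro card_mono) auto
  also have "\<dots> \<le> card ?E + 1 + card ?C + card ?D"
    using fin
    by (intro order_trans[OF card_Un_le] add_mono card_image_le) auto
  finally have "card (edges G) \<le> card ?E + 1 + card ?C + card ?D" .
  have "card ?E + card ?D = card (?E \<union> (\<lambda>w. {u, w}) ` ?D)"
  proof (subst card_Un_disjoint)
    show "?E \<inter> (\<lambda>w. {u, w}) ` ?D = {}" by auto
    have "inj_on (\<lambda>w. {u, w}) ?D" by (auto simp: inj_on_def doubleton_eq_iff)
    then show "card ?E + card ?D = card ?E + card ((\<lambda>w. {u, w}) ` ?D)" by (simp add: card_image)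
  qed (use fin in auto)
  also have "\<dots> \<le> card (edges (contract_edge G u v))"
    using finite_edges[OF simple_graph_contract_edge[OF G uv]]
    by (intro card_mono) (auto simp: contract_edge_def)
  finally have "card ?E + card ?D \<le> card (edges (contract_edge G u v))" .
  with \<open>card (edges G) \<le> card ?E + 1 + card ?C + card ?D\<close> show ?thesis by linarith
qed

section \<open>Dense graphs contain complete minors\<close>

text \<open>The apex puts a vertex back on top of its neighbourhood after contractions inside that
  neighbourhood, so each induction step of Mader's argument gains one vertex.\<close>

definition add_apex :: "'a \<Rightarrow> 'a sgraph \<Rightarrow> 'a sgraph" where
  "add_apex v G = (insert v (verts G), edges G \<union> {{v, w} | w. w \<in> verts G})"

lemma simple_graph_add_apex:
  assumes "simple_graph G" "v \<notin> verts G"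
  shows "simple_graph (add_apex v G)"
  using assms by (auto simp: simple_graph_def add_apex_def card_insert_if)

lemma contraction_step_add_apex:
  assumes G: "simple_graph G" and v: "v \<notin> verts G" and step: "contraction_step G K"
  shows "contraction_step (add_apex v G) (add_apex v K)"
proof -
  obtain a b where ab: "{a, b} \<in> edges G" "K = contract_edge G a b"
    using step by (auto simp: contraction_step_def)
  note abD = simple_graph_pairD[OF G ab(1)]
  have ne: "v \<noteq> a" "v \<noteq> b" using abD v by auto
  have "contract_edge (add_apex v G) a b = add_apex v (contract_edge G a b)"
  proof (rule prod_eqI)
    show "verts (contract_edge (add_apex v G) a b) = verts (add_apex v (contract_edge G a b))"
      using ne by (auto simp: add_apex_def contract_edge_def)
    show "edges (contract_edge (add_apex v G) a b) = edges (add_apex v (contract_edge G a b))"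
    proof (rule set_eqI)
      fix e
      have "e \<in> edges (contract_edge (add_apex v G) a b) \<longleftrightarrow>
        (e \<in> edges G \<and> b \<notin> e) \<or> (\<exists>w. e = {v, w} \<and> w \<in> verts G \<and> b \<noteq> w)
        \<or> (\<exists>w. e = {a, w} \<and> {b, w} \<in> edges G \<and> w \<noteq> a) \<or> e = {a, v}"
        using ne abD by (auto simp: add_apex_def contract_edge_def doubleton_eq_iff)
      moreover have "e \<in> edges (add_apex v (contract_edge G a b)) \<longleftrightarrow>
        (e \<in> edges G \<and> b \<notin> e) \<or> (\<exists>w. e = {v, w} \<and> w \<in> verts G \<and> b \<noteq> w)
        \<or> (\<exists>w. e = {a, w} \<and> {b, w} \<in> edges G \<and> w \<noteq> a)"
        by (auto simp: add_apex_def contract_edge_def)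
      \<comment> \<open>Contracting \<open>{a, b}\<close> turns the apex edge \<open>{b, v}\<close>
        into \<open>{a, v}\<close>, which coincides with the apex edge already present at
        \<open>a\<close>.\<close>
      moreover have "{a, v} = {v, a}" by auto
      ultimately show "e \<in> edges (contract_edge (add_apex v G) a b) \<longleftrightarrow>
          e \<in> edges (add_apex v (contract_edge G a b))"
        using abD by metis
    qed
  qed
  then show ?thesis
    unfolding contraction_step_def ab(2)
    by (intro exI[of _ a] exI[of _ b]) (use ab in \<open>auto simp: add_apex_def\<close>)
qed

lemma verts_contractions: "contraction_step\<^sup>*\<^sup>* G K \<Longrightarrow> verts K \<subseteq> verts G"
  by (induction rule: rtranclp_induct) (auto simp: contraction_step_def contract_edge_def)

lemma contractions_add_apex:
  assumes "contraction_step\<^sup>*\<^sup>* G K" "simple_graph G" "v \<notin> verts G"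
  shows "contraction_step\<^sup>*\<^sup>* (add_apex v G) (add_apex v K)"
  using assms
proof induction
  case (step K K')
  then have "contraction_step (add_apex v K) (add_apex v K')"
    using simple_graph_contractions[of G K] verts_contractions[of G K]
    by (intro contraction_step_add_apex) auto
  then show ?case using step by auto
qed simp

text \<open>Mader's argument: in a subcontraction with fewest vertices among those of the given edge
  density, every edge lies in many triangles, so the neighbourhood of a vertex is dense.\<close>

lemma complete_subcontraction:
  assumes "simple_graph G" "2 ^ r * card (verts G) \<le> card (edges G)"
  shows "\<exists>K. subcontraction K G \<and> card (verts K) = Suc r \<and>
    (\<forall>u\<in>verts K. \<forall>v\<in>verts K. u \<noteq> v \<longrightarrow> {u, v} \<in> edges K)"
  using assms
proof (induction r arbitrary: G)
  case 0
  then obtain v where "v \<in> verts G" by (auto simp: simple_graph_def)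
  then have "is_subgraph ({v}, {}) G" by (auto simp: is_subgraph_def simple_graph_def)
  then show ?case by (intro exI[of _ "({v}, {})"]) (auto intro: subcontraction_subgraph)
next
  case (Suc r)
  let ?P = "\<lambda>G'. subcontraction G' G \<and> 2 ^ Suc r * card (verts G') \<le> card (edges G')"
  have "?P G" using Suc.prems by (simp add: subcontraction_subgraph is_subgraph_refl)
  from ex_has_least_nat[of ?P, OF this, of "\<lambda>G. card (verts G)"]
  obtain G' where G': "subcontraction G' G" "2 ^ Suc r * card (verts G') \<le> card (edges G')"
    and least: "\<And>G''. ?P G'' \<Longrightarrow> card (verts G') \<le> card (verts G'')" by blast
  have simp': "simple_graph G'" using G'(1) by (rule simple_graph_subcontraction)
  note fin = finite_verts[OF simp'] finite_edges[OF simp']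
  \<comment> \<open>Otherwise contracting \<open>{u, v}\<close> costs at most
    \<open>2 ^ Suc r\<close> edges and exactly one vertex, which keeps the density and contradicts
    minimality.\<close>
  have common: "2 ^ Suc r \<le> card {w. {u, w} \<in> edges G' \<and> {v, w} \<in> edges G'}"
    if uv: "{u, v} \<in> edges G'" for u v
  proof (rule ccontr)
    assume small: "\<not> ?thesis"
    let ?G'' = "contract_edge G' u v"
    note uvD = simple_graph_pairD[OF simp' uv]
    have "card (edges G') \<le> card (edges ?G'') + 2 ^ Suc r"
      using card_edges_contract_edge[OF simp' uv] small by simp
    moreover have card: "Suc (card (verts ?G'')) = card (verts G')"
      using uvD fin by (simp add: contract_edge_def card_Diff_singleton card_gt_0_iff)
        (metis card_gt_0_iff Suc_pred empty_iff)
    moreover have "2 ^ Suc r * card (verts G') = 2 ^ Suc r * card (verts ?G'') + 2 ^ Suc r"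
      unfolding card[symmetric] by simp
    ultimately have "2 ^ Suc r * card (verts ?G'') \<le> card (edges ?G'')" using G'(2) by linarith
    moreover have "subcontraction ?G'' G"
      using subcontraction_contract_edge[OF simp' uv] G'(1) by (rule subcontraction_trans)
    ultimately show False using least[of ?G''] card by simp
  qed
  have "card (verts G') > 0" using simp' fin by (simp add: simple_graph_def card_gt_0_iff)
  then have "card (edges G') > 0" using G'(2) by (metis less_le_trans nat_0_less_mult_iff zero_less_numeral zero_less_power)
  then obtain u v where uv: "{u, v} \<in> edges G'"
    using simple_graph_edgeD(2)[OF simp'] by (metis card_2_iff card_gt_0_iff ex_in_conv)
  define M where "M = {w. {u, w} \<in> edges G'}"
  define L where "L = (M, {e \<in> edges G'. e \<subseteq> M})"
  have M: "M \<subseteq> verts G'" "u \<notin> M" "finite M" "v \<in> M"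
  proof -
    show "M \<subseteq> verts G'" "u \<notin> M" "v \<in> M"
      unfolding M_def using simple_graph_pairD[OF simp'] uv by blast+
    then show "finite M" using fin(1) finite_subset by blast
  qed
  have L: "simple_graph L" using M simple_graph_edgeD[OF simp'] by (auto simp: simple_graph_def L_def)
  \<comment> \<open>A common neighbour of \<open>u\<close> and \<open>w\<close> is a neighbour of
    \<open>w\<close> inside \<open>M\<close>. Summing these degrees counts each edge twice, and the
    halved bound is the density required for \<open>r\<close>.\<close>
  have deg: "2 ^ Suc r \<le> vdegree L w" if w: "w \<in> verts L" for w
  proof -
    let ?C = "{x. {u, x} \<in> edges G' \<and> {w, x} \<in> edges G'}"
    have "2 ^ Suc r \<le> card ?C" using w by (intro common) (simp add: L_def M_def)
    also have "\<dots> = card ((\<lambda>x. {w, x}) ` ?C)"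
      by (intro card_image[symmetric]) (auto simp: inj_on_def doubleton_eq_iff)
    also have "\<dots> \<le> card {e \<in> edges L. w \<in> e}"
      using finite_edges[OF L] w
      by (intro card_mono finite_subset[OF _ finite_edges[OF L]]) (auto simp: L_def M_def)
    finally show ?thesis by (simp add: vdegree_def)
  qed
  have "2 ^ Suc r * card (verts L) = (\<Sum>w\<in>verts L. 2 ^ Suc r)" by simp
  also have "\<dots> \<le> (\<Sum>w\<in>verts L. vdegree L w)" using deg by (rule sum_mono)
  also have "\<dots> = 2 * card (edges L)" by (rule sum_vdegree[OF L])
  finally have "2 ^ r * card (verts L) \<le> card (edges L)" by simp
  from Suc.IH[OF L this] obtain K where K: "subcontraction K L" "card (verts K) = Suc r"
    "\<forall>u\<in>verts K. \<forall>v\<in>verts K. u \<noteq> v \<longrightarrow> {u, v} \<in> edges K" by blast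
  then obtain S where S: "is_subgraph S L" "contraction_step\<^sup>*\<^sup>* S K"
    by (auto simp: subcontraction_def)
  have SM: "verts S \<subseteq> M" "simple_graph S" "edges S \<subseteq> edges G'"
    using S(1) by (auto simp: is_subgraph_def L_def)
  have "is_subgraph (add_apex u S) G'"
    unfolding is_subgraph_def
  proof (intro conjI)
    show "simple_graph (add_apex u S)" using SM M by (intro simple_graph_add_apex) auto
    show "verts (add_apex u S) \<subseteq> verts G'"
      using SM M simple_graph_pairD[OF simp' uv] by (auto simp: add_apex_def)
    show "edges (add_apex u S) \<subseteq> edges G'" using SM by (auto simp: add_apex_def M_def)
  qed
  moreover have "contraction_step\<^sup>*\<^sup>* (add_apex u S) (add_apex u K)"
    using S(2) SM(2) by (rule contractions_add_apex) (use SM M in auto)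
  ultimately have "subcontraction (add_apex u K) G'" unfolding subcontraction_def by blast
  then have "subcontraction (add_apex u K) G" using G'(1) by (rule subcontraction_trans)
  moreover have "u \<notin> verts K" using verts_contractions[OF S(2)] SM M by auto
  then have "card (verts (add_apex u K)) = Suc (Suc r)"
    using K(2) by (simp add: add_apex_def card_insert_if card_ge_0_finite)
  moreover have "\<forall>x\<in>verts (add_apex u K). \<forall>y\<in>verts (add_apex u K). x \<noteq> y \<longrightarrow> {x, y} \<in> edges (add_apex u K)"
    using K(3) by (auto simp: add_apex_def insert_commute)
  ultimately show ?case by blast
qed

lemma complete_contains_isomorphic:
  assumes H: "simple_graph H" and K: "simple_graph K" "card (verts K) \<ge> card (verts H)"
    "\<forall>u\<in>verts K. \<forall>v\<in>verts K. u \<noteq> v \<longrightarrow> {u, v} \<in> edges K"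
  shows "\<exists>T. is_subgraph T K \<and> isomorphic T H"
proof -
  obtain f where f: "inj_on f (verts H)" "f ` verts H \<subseteq> verts K"
    using card_le_inj[OF finite_verts[OF H] finite_verts[OF K(1)] K(2)] by auto
  define T where "T = (f ` verts H, (\<lambda>e. f ` e) ` edges H)"
  have edge: "f ` e \<subseteq> f ` verts H \<and> card (f ` e) = 2" if "e \<in> edges H" for e
    using simple_graph_edgeD[OF H that] card_image[OF inj_on_subset[OF f(1)], of e] by auto
  have "simple_graph T"
    using H edge by (auto simp: simple_graph_def T_def)
  moreover have "edges T \<subseteq> edges K"
  proof
    fix e assume "e \<in> edges T"
    then have "e \<subseteq> verts K" "card e = 2" using edge f(2) by (auto simp: T_def)
    then show "e \<in> edges K" using K(3) by (auto simp: card_2_iff)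
  qed
  ultimately have "is_subgraph T K" using f(2) by (auto simp: is_subgraph_def T_def)
  moreover have "isomorphic T H"
    unfolding isomorphic_def
  proof (intro exI conjI)
    show "bij_betw (inv_into (verts H) f) (verts T) (verts H)"
      using inj_on_imp_bij_betw[OF f(1)] bij_betw_inv_into by (fastforce simp: T_def)
    have "inv_into (verts H) f ` f ` e = e" if "e \<in> edges H" for e
      using simple_graph_edgeD(1)[OF H that] f(1) by (rule inv_into_image_cancel[rotated])
    then show "edges H = (\<lambda>e. inv_into (verts H) f ` e) ` edges T"
      by (auto simp: T_def image_image)
  qed
  ultimately show ?thesis by blast
qed

text \<open>The average degree is twice the number of edges per vertex, hence the exponent
  \<open>Suc\<close>. The complete minor then has enough vertices to contain a copy of
  \<open>H\<close>.\<close>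

lemma is_minor_of_dense:
  assumes H: "simple_graph H" and G: "simple_graph G"
    and deg: "average_degree G \<ge> 2 ^ Suc (card (verts H))"
  shows "is_minor H G"
proof -
  let ?r = "card (verts H)"
  have "card (verts G) > 0" using G by (auto simp: simple_graph_def card_gt_0_iff)
  then have "2 ^ Suc ?r * real (card (verts G)) \<le> 2 * real (card (edges G))"
    using deg unfolding average_degree_eq[OF G] by (simp add: pos_le_divide_eq)
  then have "real (2 ^ ?r * card (verts G)) \<le> real (card (edges G))" by simp
  then have "2 ^ ?r * card (verts G) \<le> card (edges G)" by (simp only: of_nat_le_iff)
  from complete_subcontraction[OF G this] obtain K where K: "subcontraction K G"
    "card (verts K) = Suc ?r" "\<forall>u\<in>verts K. \<forall>v\<in>verts K. u \<noteq> v \<longrightarrow> {u, v} \<in> edges K" by blast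
  obtain T where T: "is_subgraph T K" "isomorphic T H"
    using complete_contains_isomorphic[OF H simple_graph_subcontraction[OF K(1)] _ K(3)] K(2)
    by (metis le_SucI order_refl)
  have "subcontraction T G" using subcontraction_subgraph[OF T(1)] K(1) by (rule subcontraction_trans)
  then show ?thesis using T(2) unfolding subcontraction_def is_minor_def by blast
qed

text \<open>Complete minors in dense graphs are needed because \<open>Inf {}\<close> is unspecified.\<close>

lemma minor_threshold_ge:
  assumes H: "simple_graph H" and G: "simple_graph (G :: nat sgraph)"
    and "\<not> is_minor H G" "D \<le> average_degree G"
  shows "D \<le> minor_threshold H"
  unfolding minor_threshold_def
proof (rule cInf_greatest)
  show "{d. \<forall>G :: nat sgraph. simple_graph G \<and> average_degree G \<ge> d \<longrightarrow> is_minor H G} \<noteq> {}"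
    using is_minor_of_dense[OF H] by blast
  fix d assume "d \<in> {d. \<forall>G :: nat sgraph. simple_graph G \<and> average_degree G \<ge> d \<longrightarrow> is_minor H G}"
  then have "\<not> d \<le> average_degree G" using G assms(3) by blast
  then show "D \<le> d" using assms(4) by linarith
qed

section \<open>Branch sets\<close>

text \<open>The branch set of a vertex collects the vertices of \<open>S\<close> merged into it.
  Nonemptiness, disjointness and an edge of \<open>S\<close> behind every edge of \<open>K\<close>
  are the properties preserved by each contraction.\<close>

lemma contractions_branch_sets:
  assumes "contraction_step\<^sup>*\<^sup>* S K" "simple_graph S"
  shows "\<exists>B. (\<forall>x\<in>verts K. B x \<noteq> {} \<and> B x \<subseteq> verts S) \<and> disjoint_family_on B (verts K) \<and>
    (\<forall>x y. {x, y} \<in> edges K \<longrightarrow> (\<exists>a\<in>B x. \<exists>b\<in>B y. {a, b} \<in> edges S))"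
  using assms
proof induction
  case base
  show ?case
    by (intro exI[of _ "\<lambda>x. {x}"] conjI) (simp_all add: disjoint_family_on_def)
next
  case (step K K')
  obtain B where B: "\<forall>x\<in>verts K. B x \<noteq> {} \<and> B x \<subseteq> verts S" "disjoint_family_on B (verts K)"
    "\<forall>x y. {x, y} \<in> edges K \<longrightarrow> (\<exists>a\<in>B x. \<exists>b\<in>B y. {a, b} \<in> edges S)"
    using step.IH[OF step.prems] by (elim exE conjE) (rule that)
  obtain u v where uv: "{u, v} \<in> edges K" "K' = contract_edge K u v"
    using step.hyps by (auto simp: contraction_step_def)
  have K: "simple_graph K" using step simple_graph_contractions by blast
  note uvD = simple_graph_pairD[OF K uv(1)]
  \<comment> \<open>The merged vertex keeps the name \<open>u\<close>, and \<open>v\<close> leaves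
    the vertex set, so only the value at \<open>u\<close> changes.\<close>
  let ?B = "B(u := B u \<union> B v)"
  have edge: "\<exists>a\<in>?B x. \<exists>b\<in>?B y. {a, b} \<in> edges S" if xy: "{x, y} \<in> edges K'" for x y
  proof -
    consider "{x, y} \<in> edges K" | w where "{x, y} = {u, w}" "{v, w} \<in> edges K" "w \<noteq> u"
      using xy uv(2) by (auto simp: contract_edge_def)
    then show ?thesis
    proof cases
      case 1
      then obtain a b where "a \<in> B x" "b \<in> B y" "{a, b} \<in> edges S" using B(3) by blast
      then show ?thesis by auto
    next
      case 2
      then obtain a b where ab: "a \<in> B v" "b \<in> B w" "{a, b} \<in> edges S" using B(3) by blast
      then have "{b, a} \<in> edges S" by (simp add: insert_commute)
      with ab 2 show ?thesis by (auto simp: doubleton_eq_iff)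
    qed
  qed
  have "disjoint_family_on ?B (verts K')"
    using B(2) uvD uv(2) unfolding disjoint_family_on_def contract_edge_def by (auto; blast)
  moreover have "\<forall>x\<in>verts K'. ?B x \<noteq> {} \<and> ?B x \<subseteq> verts S"
    using B(1) uvD uv(2) by (auto simp: contract_edge_def)
  ultimately show ?case using edge by blast
qed

lemma is_minor_branch_sets:
  assumes "is_minor H G"
  shows "\<exists>B. (\<forall>x\<in>verts H. B x \<noteq> {} \<and> B x \<subseteq> verts G) \<and> disjoint_family_on B (verts H) \<and>
    (\<forall>x y. {x, y} \<in> edges H \<longrightarrow> (\<exists>a\<in>B x. \<exists>b\<in>B y. {a, b} \<in> edges G))"
proof -
  obtain S K where S: "is_subgraph S G" "contraction_step\<^sup>*\<^sup>* S K" "isomorphic K H"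
    using assms unfolding is_minor_def by (elim exE conjE) (rule that)
  have S': "simple_graph S" "verts S \<subseteq> verts G" "edges S \<subseteq> edges G"
    using S(1) by (auto simp: is_subgraph_def)
  have K: "simple_graph K" using S(2) S'(1) simple_graph_contractions by blast
  obtain \<phi> where \<phi>: "bij_betw \<phi> (verts K) (verts H)" "edges H = (\<lambda>e. \<phi> ` e) ` edges K"
    using S(3) by (auto simp: isomorphic_def)
  obtain B where B: "\<forall>x\<in>verts K. B x \<noteq> {} \<and> B x \<subseteq> verts S" "disjoint_family_on B (verts K)"
    "\<forall>x y. {x, y} \<in> edges K \<longrightarrow> (\<exists>a\<in>B x. \<exists>b\<in>B y. {a, b} \<in> edges S)"
    using contractions_branch_sets[OF S(2) S'(1)] by blast
  define \<psi> where "\<psi> = inv_into (verts K) \<phi>"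
  have \<psi>: "bij_betw \<psi> (verts H) (verts K)" unfolding \<psi>_def by (rule bij_betw_inv_into[OF \<phi>(1)])
  have \<psi>V: "\<psi> x \<in> verts K" if "x \<in> verts H" for x using bij_betwE[OF \<psi>] that by blast
  have "disjoint_family_on (B \<circ> \<psi>) (verts H)"
    unfolding disjoint_family_on_def
  proof (intro ballI impI)
    fix m n assume "m \<in> verts H" "n \<in> verts H" "m \<noteq> n"
    then show "(B \<circ> \<psi>) m \<inter> (B \<circ> \<psi>) n = {}"
      using B(2) \<psi>V inj_onD[OF bij_betw_imp_inj_on[OF \<psi>]] unfolding disjoint_family_on_def
      by (metis comp_apply)
  qed
  moreover have "{\<psi> x, \<psi> y} \<in> edges K" if xy: "{x, y} \<in> edges H" for x y
  proof -
    obtain e where e: "e \<in> edges K" "{x, y} = \<phi> ` e" using xy \<phi>(2) by auto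
    have "\<psi> ` \<phi> ` e = e"
      unfolding \<psi>_def using simple_graph_edgeD(1)[OF K e(1)] bij_betw_imp_inj_on[OF \<phi>(1)]
      by (rule inv_into_image_cancel[rotated])
    then show ?thesis using e by (metis image_empty image_insert)
  qed
  then have "\<exists>a\<in>B (\<psi> x). \<exists>b\<in>B (\<psi> y). {a, b} \<in> edges G" if "{x, y} \<in> edges H" for x y
    using B(3) S'(3) that by blast
  ultimately show ?thesis
    using B(1) S'(2) \<psi>V by (intro exI[of _ "B \<circ> \<psi>"]) (auto; blast)
qed

section \<open>Random subsets and the base graph\<close>

text \<open>The expectation of \<open>g\<close> over the random subset of \<open>A\<close> containing each element with probability
  \<open>p\<close> independently.\<close>

definition bernoulli_sum :: "real \<Rightarrow> 'a set \<Rightarrow> ('a set \<Rightarrow> real) \<Rightarrow> real" where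
  "bernoulli_sum p A g = (\<Sum>E\<in>Pow A. p ^ card E * (1 - p) ^ card (A - E) * g E)"

lemma bernoulli_sum_empty [simp]: "bernoulli_sum p {} g = g {}"
  by (simp add: bernoulli_sum_def)

text \<open>Conditioning on whether \<open>a\<close> is chosen; this recursion drives the inductions
  that evaluate expectations.\<close>

lemma bernoulli_sum_insert:
  assumes "finite A" "a \<notin> A"
  shows "bernoulli_sum p (insert a A) g =
    p * bernoulli_sum p A (\<lambda>E. g (insert a E)) + (1 - p) * bernoulli_sum p A g"
proof -
  let ?f = "\<lambda>E. p ^ card E * (1 - p) ^ card (insert a A - E) * g E"
  have fin: "finite E" "a \<notin> E" if "E \<in> Pow A" for E
    using that assms finite_subset by auto
  have "sum ?f (Pow (insert a A)) = sum ?f (Pow A) + sum ?f (insert a ` Pow A)"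
    unfolding Pow_insert using assms by (intro sum.union_disjoint) auto
  also have "sum ?f (insert a ` Pow A) = (\<Sum>E\<in>Pow A. ?f (insert a E))"
    using assms(2) by (intro sum.reindex_cong[OF _ refl refl]) (auto simp: inj_on_def)
  also have "\<dots> = p * bernoulli_sum p A (\<lambda>E. g (insert a E))"
    unfolding bernoulli_sum_def sum_distrib_left
  proof (rule sum.cong[OF refl])
    fix E assume E: "E \<in> Pow A"
    have "insert a A - insert a E = A - E" using assms(2) by auto
    then show "?f (insert a E) = p * (p ^ card E * (1 - p) ^ card (A - E) * g (insert a E))"
      using fin[OF E] by simp
  qed
  also have "sum ?f (Pow A) = (1 - p) * bernoulli_sum p A g"
    unfolding bernoulli_sum_def sum_distrib_left
  proof (rule sum.cong[OF refl])
    fix E assume E: "E \<in> Pow A"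
    have "insert a A - E = insert a (A - E)" using fin[OF E] by auto
    then show "?f E = (1 - p) * (p ^ card E * (1 - p) ^ card (A - E) * g E)"
      using assms by simp
  qed
  finally show ?thesis by (simp add: bernoulli_sum_def)
qed

lemma bernoulli_sum_cong:
  "(\<And>E. E \<subseteq> A \<Longrightarrow> g E = h E) \<Longrightarrow> bernoulli_sum p A g = bernoulli_sum p A h"
  unfolding bernoulli_sum_def by (intro sum.cong) auto

lemma bernoulli_sum_mono:
  "0 \<le> p \<Longrightarrow> p \<le> 1 \<Longrightarrow> (\<And>E. E \<subseteq> A \<Longrightarrow> g E \<le> h E) \<Longrightarrow>
    bernoulli_sum p A g \<le> bernoulli_sum p A h"
  unfolding bernoulli_sum_def by (intro sum_mono mult_left_mono) auto

lemma bernoulli_sum_cmult: "bernoulli_sum p A (\<lambda>E. c * g E) = c * bernoulli_sum p A g"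
  unfolding bernoulli_sum_def sum_distrib_left by (intro sum.cong) auto

lemma bernoulli_sum_add:
  "bernoulli_sum p A (\<lambda>E. g E + h E) = bernoulli_sum p A g + bernoulli_sum p A h"
  unfolding bernoulli_sum_def sum.distrib[symmetric] by (intro sum.cong) (auto simp: algebra_simps)

lemma bernoulli_sum_sum:
  "bernoulli_sum p A (\<lambda>E. \<Sum>i\<in>I. g i E) = (\<Sum>i\<in>I. bernoulli_sum p A (g i))"
  unfolding bernoulli_sum_def sum_distrib_left by (rule sum.swap)

lemma bernoulli_sum_const:
  assumes "finite A" shows "bernoulli_sum p A (\<lambda>_. c) = c"
  using assms by induction (auto simp: bernoulli_sum_insert algebra_simps)

lemma bernoulli_sum_card:
  assumes "finite A" shows "bernoulli_sum p A (\<lambda>E. real (card E)) = p * real (card A)"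
  using assms
proof induction
  case (insert a A)
  have "bernoulli_sum p A (\<lambda>E. real (card (insert a E))) = bernoulli_sum p A (\<lambda>E. real (card E) + 1)"
  proof (rule bernoulli_sum_cong)
    fix E assume "E \<subseteq> A"
    then have "finite E" "a \<notin> E" using insert.hyps finite_subset by auto
    then show "real (card (insert a E)) = real (card E) + 1" by simp
  qed
  then show ?case
    using insert by (simp add: bernoulli_sum_insert bernoulli_sum_add bernoulli_sum_const algebra_simps)
qed simp

lemma bernoulli_sum_nonempty:
  assumes "finite A"
  shows "bernoulli_sum p A (\<lambda>E. of_bool (E \<noteq> {})) = 1 - (1 - p) ^ card A"
  using assms
proof induction
  case (insert a A)
  have "bernoulli_sum p (insert a A) (\<lambda>E. of_bool (E \<noteq> {})) = p * 1 + (1 - p) * (1 - (1 - p) ^ card A)"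
    unfolding bernoulli_sum_insert[OF insert.hyps(1,2)] insert.IH
    using bernoulli_sum_const[OF insert.hyps(1), of p 1] by simp
  then show ?case using insert.hyps by (simp add: algebra_simps)
qed simp

text \<open>Independence of the traces on disjoint sets. Conditioning on one element of
  \<open>F\<close> replaces \<open>g\<close> by its composite with \<open>insert a\<close>, so the
  induction keeps \<open>g\<close> arbitrary.\<close>

lemma bernoulli_sum_prod:
  assumes "finite F" "finite A" "F \<inter> A = {}"
  shows "bernoulli_sum p (F \<union> A) (\<lambda>E. g (E \<inter> F) * h (E \<inter> A))
    = bernoulli_sum p F g * bernoulli_sum p A h"
  using assms
proof (induction F arbitrary: g)
  case empty
  have "bernoulli_sum p A (\<lambda>E. g {} * h (E \<inter> A)) = bernoulli_sum p A (\<lambda>E. g {} * h E)"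
    by (intro bernoulli_sum_cong) (simp add: Int_absorb2)
  then show ?case by (simp add: bernoulli_sum_cmult)
next
  case (insert a F)
  have a: "a \<notin> F \<union> A" "finite (F \<union> A)" using insert by auto
  have "bernoulli_sum p (F \<union> A) (\<lambda>E. g (insert a E \<inter> insert a F) * h (insert a E \<inter> A))
    = bernoulli_sum p (F \<union> A) (\<lambda>E. g (insert a (E \<inter> F)) * h (E \<inter> A))"
    using a by (intro bernoulli_sum_cong) auto
  also have "\<dots> = bernoulli_sum p F (\<lambda>E. g (insert a E)) * bernoulli_sum p A h"
    using insert.IH[of "\<lambda>E. g (insert a E)"] insert.prems by simp
  finally have 1: "bernoulli_sum p (F \<union> A) (\<lambda>E. g (insert a E \<inter> insert a F) * h (insert a E \<inter> A))
    = bernoulli_sum p F (\<lambda>E. g (insert a E)) * bernoulli_sum p A h" .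
  have "bernoulli_sum p (F \<union> A) (\<lambda>E. g (E \<inter> insert a F) * h (E \<inter> A))
    = bernoulli_sum p (F \<union> A) (\<lambda>E. g (E \<inter> F) * h (E \<inter> A))"
  proof (rule bernoulli_sum_cong)
    fix E assume "E \<subseteq> F \<union> A"
    then have "E \<inter> insert a F = E \<inter> F" using a by auto
    then show "g (E \<inter> insert a F) * h (E \<inter> A) = g (E \<inter> F) * h (E \<inter> A)" by simp
  qed
  also have "\<dots> = bernoulli_sum p F g * bernoulli_sum p A h"
    using insert.IH[of g] insert.prems by simp
  finally have 2: "bernoulli_sum p (F \<union> A) (\<lambda>E. g (E \<inter> insert a F) * h (E \<inter> A))
    = bernoulli_sum p F g * bernoulli_sum p A h" .
  show ?case
    using a insert.hyps unfolding Un_insert_left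
    by (simp only: bernoulli_sum_insert[OF a(2,1)] 1 2 bernoulli_sum_insert[OF insert.hyps(1,2)])
      (simp add: algebra_simps)
qed

text \<open>Disjoint sets are hit independently, and a set of size at most \<open>L\<close> is
  missed with probability at least \<open>(1 - p) ^ L\<close>. The induction splits off one
  \<open>F j\<close> and continues in \<open>A - F j\<close>, hence the arbitrary
  \<open>A\<close>.\<close>

lemma bernoulli_sum_hit_all:
  assumes "finite J" "finite A" "disjoint_family_on F J" "0 \<le> p" "p \<le> 1"
    and "\<And>j. j \<in> J \<Longrightarrow> F j \<subseteq> A" "\<And>j. j \<in> J \<Longrightarrow> card (F j) \<le> L"
  shows "bernoulli_sum p A (\<lambda>E. of_bool (\<forall>j\<in>J. E \<inter> F j \<noteq> {})) \<le> (1 - (1 - p) ^ L) ^ card J"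
  using assms
proof (induction J arbitrary: A)
  case empty
  then show ?case by (simp add: bernoulli_sum_const)
next
  case (insert j J)
  let ?A = "A - F j"
  let ?g = "\<lambda>E. of_bool (E \<noteq> {}) :: real" and ?h = "\<lambda>E. of_bool (\<forall>i\<in>J. E \<inter> F i \<noteq> {}) :: real"
  have Fj: "F j \<subseteq> A" using insert.prems by blast
  then have FA: "F j \<union> ?A = A" "finite (F j)" using insert.prems(1) by (auto intro: finite_subset)
  have sub: "F i \<subseteq> ?A" if "i \<in> J" for i
    using insert.prems(2) insert.prems(5)[of i] that insert.hyps(2)
    by (auto simp: disjoint_family_on_def)
  have "bernoulli_sum p A (\<lambda>E. of_bool (\<forall>i\<in>insert j J. E \<inter> F i \<noteq> {}))
    = bernoulli_sum p A (\<lambda>E. ?g (E \<inter> F j) * ?h (E \<inter> ?A))"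
  proof (rule bernoulli_sum_cong)
    fix E assume "E \<subseteq> A"
    have "E \<inter> ?A \<inter> F i = E \<inter> F i" if "i \<in> J" for i using sub[OF that] by auto
    then show "of_bool (\<forall>i\<in>insert j J. E \<inter> F i \<noteq> {}) = ?g (E \<inter> F j) * ?h (E \<inter> ?A)"
      by simp
  qed
  also have "\<dots> = bernoulli_sum p (F j \<union> ?A) (\<lambda>E. ?g (E \<inter> F j) * ?h (E \<inter> ?A))"
    by (simp only: FA)
  also have "\<dots> = bernoulli_sum p (F j) ?g * bernoulli_sum p ?A ?h"
    using FA insert.prems by (intro bernoulli_sum_prod) auto
  also have "\<dots> \<le> (1 - (1 - p) ^ L) * (1 - (1 - p) ^ L) ^ card J"
  proof (rule mult_mono)
    show "bernoulli_sum p (F j) ?g \<le> 1 - (1 - p) ^ L"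
      using bernoulli_sum_nonempty[OF FA(2), of p] insert.prems
      by (simp add: power_decreasing)
    show "bernoulli_sum p ?A ?h \<le> (1 - (1 - p) ^ L) ^ card J"
    proof (rule insert.IH)
      show "disjoint_family_on F J"
        using insert.prems(2) by (auto simp: disjoint_family_on_def)
    qed (use insert.prems sub in auto)
    show "0 \<le> 1 - (1 - p) ^ L" using insert.prems by (simp add: power_le_one)
    show "0 \<le> bernoulli_sum p ?A ?h"
      unfolding bernoulli_sum_def using insert.prems by (intro sum_nonneg) auto
  qed
  finally show ?case using insert.hyps by simp
qed

section \<open>Systems of small sets in a random base graph\<close>

lemma card_small_subsets_le:
  "card {X. X \<subseteq> {..<N} \<and> card X \<le> s} \<le> (N + 1) ^ s"
proof -
  let ?F = "{..<s} \<rightarrow>\<^sub>E {..N}"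
  have "{X. X \<subseteq> {..<N} \<and> card X \<le> s} \<subseteq> (\<lambda>f. f ` {..<s} \<inter> {..<N}) ` ?F"
  proof
    fix X assume "X \<in> {X. X \<subseteq> {..<N} \<and> card X \<le> s}"
    then have X: "X \<subseteq> {..<N}" "card X \<le> s" "finite X" by (auto intro: finite_subset)
    obtain h where h: "bij_betw h {0..<card X} X" using ex_bij_betw_nat_finite[OF X(3)] by blast
    let ?f = "\<lambda>i\<in>{..<s}. if i < card X then h i else N"
    have "h i \<le> N" if "i < card X" for i using bij_betwE[OF h] that X(1) by fastforce
    then have "?f \<in> ?F" by (auto simp: PiE_iff)
    moreover have "?f ` {..<s} \<inter> {..<N} = X"
    proof
      show "?f ` {..<s} \<inter> {..<N} \<subseteq> X" using bij_betwE[OF h] by auto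
      show "X \<subseteq> ?f ` {..<s} \<inter> {..<N}"
      proof
        fix x assume x: "x \<in> X"
        then obtain i where "i < card X" "h i = x"
          using bij_betw_imp_surj_on[OF h] by (metis atLeastLessThan_iff imageE)
        then show "x \<in> ?f ` {..<s} \<inter> {..<N}"
          using X x by (intro IntI image_eqI[of _ _ i]) auto
      qed
    qed
    ultimately show "X \<in> (\<lambda>f. f ` {..<s} \<inter> {..<N}) ` ?F" by (intro image_eqI[of _ _ ?f]) auto
  qed
  then have "card {X. X \<subseteq> {..<N} \<and> card X \<le> s} \<le> card ((\<lambda>f. f ` {..<s} \<inter> {..<N}) ` ?F)"
    by (intro card_mono finite_imageI finite_PiE) auto
  also have "\<dots> \<le> card ?F" by (intro card_image_le finite_PiE) auto
  finally show ?thesis by (simp add: card_PiE)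
qed

lemma finite_small_subsets: "finite {X. X \<subseteq> {..<N::nat} \<and> card X \<le> s}"
  by (rule finite_subset[of _ "Pow {..<N}"]) auto

definition adjacent_in :: "'a set set \<Rightarrow> 'a set \<Rightarrow> 'a set \<Rightarrow> bool" where
  "adjacent_in E X Y \<longleftrightarrow> (\<exists>x\<in>X. \<exists>y\<in>Y. {x, y} \<in> E)"

lemma adjacent_in_commute: "adjacent_in E X Y \<longleftrightarrow> adjacent_in E Y X"
  unfolding adjacent_in_def by (metis insert_commute)

text \<open>Extensional functions make the candidates \<open>W\<close> a finite set over which a
  union bound can run. Taking \<open>j < i\<close> lists every unordered pair of indices
  once.\<close>

definition clique_of_small_sets :: "nat \<Rightarrow> nat \<Rightarrow> nat \<Rightarrow> nat set set \<Rightarrow> (nat \<Rightarrow> nat set) \<Rightarrow> bool" where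
  "clique_of_small_sets N s r E W \<longleftrightarrow> W \<in> {..<r} \<rightarrow>\<^sub>E {X. X \<subseteq> {..<N} \<and> card X \<le> s} \<and>
     disjoint_family_on W {..<r} \<and> (\<forall>i<r. \<forall>j<i. adjacent_in E (W i) (W j))"

abbreviation pairs :: "'a set \<Rightarrow> 'a set set" where
  "pairs V \<equiv> {e. e \<subseteq> V \<and> card e = 2}"

lemma card_triangle: "card (SIGMA i:{..<r}. {..<i::nat}) = r choose 2"
proof -
  have "card (SIGMA i:{..<r}. {..<i}) = (\<Sum>i<r. i)" by simp
  also have "\<dots> = r choose 2" by (induction r) (auto simp: numeral_2_eq_2)
  finally show ?thesis .
qed

text \<open>For disjoint \<open>W i\<close> the sets of possible edges between different pairs of
  them are disjoint, each of size at most \<open>s * s\<close>, and a clique hits all of them. If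
  the \<open>W i\<close> are not disjoint, the expectation is 0.\<close>

lemma bernoulli_sum_clique_of_small_sets:
  assumes p: "0 \<le> p" "p \<le> 1"
    and W: "W \<in> {..<r} \<rightarrow>\<^sub>E {X. X \<subseteq> {..<N} \<and> card X \<le> s}"
  shows "bernoulli_sum p (pairs {..<N}) (\<lambda>E. of_bool (clique_of_small_sets N s r E W))
    \<le> (1 - (1 - p) ^ (s * s)) ^ (r choose 2)"
proof (cases "disjoint_family_on W {..<r}")
  case False
  then show ?thesis
    using p by (simp add: clique_of_small_sets_def bernoulli_sum_def power_le_one)
next
  case True
  let ?J = "SIGMA i:{..<r}. {..<i}"
  let ?F = "\<lambda>(i, j). (\<lambda>(x, y). {x, y}) ` (W i \<times> W j)"
  have disj: "W i \<inter> W j = {}" if "i < r" "j < r" "i \<noteq> j" for i j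
    using True that by (auto simp: disjoint_family_on_def)
  have W': "W i \<subseteq> {..<N}" "card (W i) \<le> s" "finite (W i)" if "i < r" for i
    using W that by (auto simp: PiE_iff intro: finite_subset)
  \<comment> \<open>A shared edge forces the two index pairs to agree up to order, by disjointness
    of the sets; \<open>j < i\<close> and \<open>j' < i'\<close> exclude the swap.\<close>
  have eq: "i = i' \<and> j = j'" if m: "(i, j) \<in> ?J" "(i', j') \<in> ?J" and e: "e \<in> ?F (i, j)" "e \<in> ?F (i', j')" for i j i' j' e
  proof -
    have ij: "i < r" "j < i" "i' < r" "j' < i'" using m by auto
    obtain x y x' y' where "x \<in> W i" "y \<in> W j" "x' \<in> W i'" "y' \<in> W j'" "{x, y} = {x', y'}"
      using e by fastforce
    then have "(W i \<inter> W i' \<noteq> {} \<and> W j \<inter> W j' \<noteq> {}) \<or> (W i \<inter> W j' \<noteq> {} \<and> W j \<inter> W i' \<noteq> {})"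
      by (auto simp: doubleton_eq_iff)
    moreover have "j < r" "j' < r" using ij by auto
    ultimately have "(i = i' \<and> j = j') \<or> (i = j' \<and> j = i')"
      using disj ij by metis
    then show ?thesis using ij by auto
  qed
  have "disjoint_family_on ?F ?J"
    unfolding disjoint_family_on_def
  proof (intro ballI impI)
    fix m n assume "m \<in> ?J" "n \<in> ?J" "m \<noteq> n"
    then show "?F m \<inter> ?F n = {}"
      using eq[of "fst m" "snd m" "fst n" "snd n"] by (auto simp: prod_eq_iff)
  qed
  moreover have "?F m \<subseteq> pairs {..<N}" if "m \<in> ?J" for m
  proof
    fix e assume "e \<in> ?F m"
    then obtain x y where xy: "x \<in> W (fst m)" "y \<in> W (snd m)" "e = {x, y}" by (auto split: prod.splits)
    have "fst m < r" "snd m < r" "fst m \<noteq> snd m" using that by auto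
    then have "x \<noteq> y" "x < N" "y < N" using disj[of "fst m" "snd m"] W'(1) xy by auto
    then show "e \<in> pairs {..<N}" using xy by auto
  qed
  moreover have "card (?F m) \<le> s * s" if "m \<in> ?J" for m
  proof -
    have m: "fst m < r" "snd m < r" using that by auto
    have "card (?F m) \<le> card (W (fst m) \<times> W (snd m))"
      unfolding case_prod_beta using W'(3) m by (intro card_image_le finite_cartesian_product) auto
    also have "\<dots> \<le> s * s" unfolding card_cartesian_product using W'(2) m by (intro mult_mono) auto
    finally show ?thesis .
  qed
  ultimately have "bernoulli_sum p (pairs {..<N}) (\<lambda>E. of_bool (\<forall>m\<in>?J. E \<inter> ?F m \<noteq> {}))
      \<le> (1 - (1 - p) ^ (s * s)) ^ card ?J"
    using p by (intro bernoulli_sum_hit_all) auto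
  moreover have "bernoulli_sum p (pairs {..<N}) (\<lambda>E. of_bool (clique_of_small_sets N s r E W))
    \<le> bernoulli_sum p (pairs {..<N}) (\<lambda>E. of_bool (\<forall>m\<in>?J. E \<inter> ?F m \<noteq> {}))"
  proof (rule bernoulli_sum_mono[OF p])
    fix E
    have "\<forall>m\<in>?J. E \<inter> ?F m \<noteq> {}" if "clique_of_small_sets N s r E W"
    proof
      fix m assume "m \<in> ?J"
      then have "adjacent_in E (W (fst m)) (W (snd m))"
        using that by (auto simp: clique_of_small_sets_def)
      then obtain x y where "x \<in> W (fst m)" "y \<in> W (snd m)" "{x, y} \<in> E"
        by (auto simp: adjacent_in_def)
      then have "{x, y} \<in> E \<inter> ?F m" by (auto simp: case_prod_beta intro!: image_eqI[of _ _ "(x, y)"])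
      then show "E \<inter> ?F m \<noteq> {}" by (metis empty_iff)
    qed
    then show "of_bool (clique_of_small_sets N s r E W) \<le> (of_bool (\<forall>m\<in>?J. E \<inter> ?F m \<noteq> {}) :: real)"
      by auto
  qed
  ultimately show ?thesis using card_triangle[of r] by simp
qed

text \<open>Since the failure probability is below \<open>\<eta>\<close>, comparing the expected number of edges
  with the pointwise bound below saves a concentration inequality.\<close>

lemma exists_host:
  assumes p: "0 \<le> p" "p \<le> 1" and N: "2 \<le> N" and \<eta>: "\<eta> \<le> p"
    and bound: "real (((N + 1) ^ s) ^ r) * (1 - (1 - p) ^ (s * s)) ^ (r choose 2) < \<eta>"
  shows "\<exists>E\<subseteq>pairs {..<N}. (p - \<eta>) * real (N choose 2) \<le> real (card E) \<and>
    (\<forall>W. \<not> clique_of_small_sets N s r E W)"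
proof (rule ccontr)
  assume none: "\<not> ?thesis"
  let ?A = "pairs {..<N}" and ?X = "{X. X \<subseteq> {..<N} \<and> card X \<le> s}"
  let ?F = "{..<r} \<rightarrow>\<^sub>E ?X"
  let ?M = "real (N choose 2)"
  have finA: "finite ?A" by (rule finite_subset[of _ "Pow {..<N}"]) auto
  have cardA: "card ?A = N choose 2" using n_subsets[of "{..<N}" 2] by simp
  have finF: "finite ?F" using finite_small_subsets by (intro finite_PiE) auto
  let ?b = "\<lambda>E. \<Sum>W\<in>?F. of_bool (clique_of_small_sets N s r E W) :: real"
  \<comment> \<open>\<open>?b E\<close> counts the cliques. If there is one, the first summand is at
    least the number of all pairs; if there is none, the assumption to be refuted puts
    \<open>card E\<close> below the second summand.\<close>
  have "real (card E) \<le> ?M * ?b E + (p - \<eta>) * ?M" if E: "E \<subseteq> ?A" for E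
  proof (cases "\<exists>W. clique_of_small_sets N s r E W")
    case True
    then obtain W where W: "clique_of_small_sets N s r E W" by blast
    then have "W \<in> ?F" by (simp add: clique_of_small_sets_def)
    then have b: "1 \<le> ?b E"
      using member_le_sum[of W ?F "\<lambda>W. of_bool (clique_of_small_sets N s r E W) :: real"] finF W by auto
    have cE: "real (card E) \<le> ?M" using card_mono[OF finA E] cardA by simp
    have "?M * 1 \<le> ?M * ?b E" using b by (intro mult_left_mono) auto
    moreover have "0 \<le> (p - \<eta>) * ?M" using \<eta> by simp
    ultimately show ?thesis using cE by linarith
  next
    case False
    then have "real (card E) < (p - \<eta>) * ?M" using none E by (meson not_le)
    moreover have "0 \<le> ?b E" by (intro sum_nonneg) auto
    ultimately show ?thesis by (smt (verit) mult_nonneg_nonneg of_nat_0_le_iff)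
  qed
  then have "bernoulli_sum p ?A (\<lambda>E. real (card E)) \<le> bernoulli_sum p ?A (\<lambda>E. ?M * ?b E + (p - \<eta>) * ?M)"
    using p by (intro bernoulli_sum_mono) auto
  then have "p * ?M \<le> ?M * (\<Sum>W\<in>?F. bernoulli_sum p ?A (\<lambda>E. of_bool (clique_of_small_sets N s r E W)))
      + (p - \<eta>) * ?M"
    by (simp only: bernoulli_sum_card[OF finA] bernoulli_sum_add bernoulli_sum_cmult
        bernoulli_sum_sum bernoulli_sum_const[OF finA] cardA)
  also have "(\<Sum>W\<in>?F. bernoulli_sum p ?A (\<lambda>E. of_bool (clique_of_small_sets N s r E W)))
      \<le> (\<Sum>W\<in>?F. (1 - (1 - p) ^ (s * s)) ^ (r choose 2))"
    using p by (intro sum_mono bernoulli_sum_clique_of_small_sets) auto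
  also have "\<dots> = real (card ?F) * (1 - (1 - p) ^ (s * s)) ^ (r choose 2)" by simp
  also have "\<dots> \<le> real (((N + 1) ^ s) ^ r) * (1 - (1 - p) ^ (s * s)) ^ (r choose 2)"
  proof (rule mult_right_mono)
    have "card ?F = card ?X ^ r" by (simp add: card_PiE)
    also have "\<dots> \<le> ((N + 1) ^ s) ^ r" using card_small_subsets_le by (intro power_mono) auto
    finally show "real (card ?F) \<le> real (((N + 1) ^ s) ^ r)" by (simp only: of_nat_le_iff)
    show "0 \<le> (1 - (1 - p) ^ (s * s)) ^ (r choose 2)" using p by (simp add: power_le_one)
  qed
  finally have "p * ?M \<le> ?M * (real (((N + 1) ^ s) ^ r) * (1 - (1 - p) ^ (s * s)) ^ (r choose 2)) + (p - \<eta>) * ?M"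
    by (simp add: mult_left_mono)
  moreover have "0 < ?M" using N by simp
  then have "?M * (real (((N + 1) ^ s) ^ r) * (1 - (1 - p) ^ (s * s)) ^ (r choose 2)) < ?M * \<eta>"
    using bound by (rule mult_strict_left_mono[rotated])
  ultimately show False by (simp add: algebra_simps)
qed

section \<open>A weak form of Turan's theorem\<close>

text \<open>Greedy choice: taking an element and discarding everything related to it removes at most
  \<open>D\<close> elements, so \<open>r\<close> rounds are possible.\<close>

lemma exists_independent_subset:
  fixes R :: "'a \<Rightarrow> 'a \<Rightarrow> bool"
  assumes "finite J" "\<And>u. u \<in> J \<Longrightarrow> card {v \<in> J. v \<noteq> u \<and> R u v} < D" "r * D \<le> card J" "0 < D"
    and sym: "\<And>u v. R u v \<Longrightarrow> R v u"
  shows "\<exists>X\<subseteq>J. card X = r \<and> (\<forall>u\<in>X. \<forall>v\<in>X. u \<noteq> v \<longrightarrow> \<not> R u v)"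
  using assms(1-4)
proof (induction r arbitrary: J)
  case 0
  then show ?case by (intro exI[of _ "{}"]) auto
next
  case (Suc r)
  have "J \<noteq> {}" using Suc.prems by auto
    then obtain u where u: "u \<in> J" by auto
    let ?N = "{v \<in> J. v \<noteq> u \<and> R u v}"
    let ?J = "J - insert u ?N"
    have fin: "finite ?N" using Suc.prems(1) by simp
    have "card (insert u ?N) = Suc (card ?N)" using fin by (simp add: card_insert_if)
    then have "card (insert u ?N) \<le> D" using Suc.prems(2)[OF u] by simp
    moreover have "card ?J = card J - card (insert u ?N)"
      using fin u by (intro card_Diff_subset) auto
    ultimately have "r * D \<le> card ?J" using Suc.prems(3) by simp
    moreover have "card {w \<in> ?J. w \<noteq> v \<and> R v w} < D" if "v \<in> ?J" for v
    proof -
      have "card {w \<in> ?J. w \<noteq> v \<and> R v w} \<le> card {w \<in> J. w \<noteq> v \<and> R v w}"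
        using Suc.prems(1) by (intro card_mono) auto
      then show ?thesis using Suc.prems(2)[of v] that by simp
    qed
    ultimately obtain X where X: "X \<subseteq> ?J" "card X = r" "\<forall>u\<in>X. \<forall>v\<in>X. u \<noteq> v \<longrightarrow> \<not> R u v"
      using Suc.IH[of ?J] Suc.prems(1,4) by blast
    have "finite X" using X(1) Suc.prems(1) finite_subset by blast
    then have "card (insert u X) = Suc r" using X(1,2) by (subst card_insert_disjoint) auto
    moreover have "\<forall>a\<in>insert u X. \<forall>b\<in>insert u X. a \<noteq> b \<longrightarrow> \<not> R a b"
      using X(1,3) sym by blast
    ultimately show ?case using X(1) u by (intro exI[of _ "insert u X"] conjI) auto
qed

text \<open>With \<open>D\<close> about \<open>card I / (2 * r)\<close>, the elements of degree
  below \<open>D\<close> number fewer than \<open>r * D\<close>, or the greedy choice would find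
  \<open>r\<close> unrelated ones. So at least half of \<open>I\<close> has degree at least
  \<open>D\<close>.\<close>

lemma many_related_pairs:
  fixes R :: "'a \<Rightarrow> 'a \<Rightarrow> bool"
  assumes fin: "finite I" and sym: "\<And>u v. R u v \<Longrightarrow> R v u" and r: "0 < r" "4 * r \<le> card I"
    and no_indep: "\<And>X. X \<subseteq> I \<Longrightarrow> card X = r \<Longrightarrow> \<exists>u\<in>X. \<exists>v\<in>X. u \<noteq> v \<and> R u v"
  shows "(real (card I))\<^sup>2 / (8 * real r) \<le> real (card {(u, v). u \<in> I \<and> v \<in> I \<and> u \<noteq> v \<and> R u v})"
proof -
  let ?n = "card I"
  define D where "D = ?n div (2 * r)"
  let ?N = "\<lambda>u. {v \<in> I. v \<noteq> u \<and> R u v}"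
  let ?J = "{u \<in> I. card (?N u) < D}"
  have rD: "2 * (r * D) \<le> ?n" unfolding D_def by (metis mult.assoc times_div_less_eq_dividend)
  have D0: "0 < D" unfolding D_def using r by (simp add: div_greater_zero_iff)
  have "\<not> r * D \<le> card ?J"
  proof
    assume "r * D \<le> card ?J"
    moreover have "card {v \<in> ?J. v \<noteq> u \<and> R u v} < D" if "u \<in> ?J" for u
    proof -
      have "card {v \<in> ?J. v \<noteq> u \<and> R u v} \<le> card (?N u)" using fin by (intro card_mono) auto
      then show ?thesis using that by auto
    qed
    ultimately have "\<exists>X\<subseteq>?J. card X = r \<and> (\<forall>u\<in>X. \<forall>v\<in>X. u \<noteq> v \<longrightarrow> \<not> R u v)"
      using fin D0 sym by (intro exists_independent_subset[where D = D]) simp_all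
    then obtain X where X: "X \<subseteq> ?J" "card X = r" "\<forall>u\<in>X. \<forall>v\<in>X. u \<noteq> v \<longrightarrow> \<not> R u v"
      by blast
    have "X \<subseteq> I" using X(1) by blast
    then show False using no_indep[of X] X(2,3) by blast
  qed
  moreover have "card (I - ?J) = ?n - card ?J" using fin by (intro card_Diff_subset) auto
  ultimately have half: "?n \<le> 2 * card (I - ?J)" using rD by linarith
  have "{(u, v). u \<in> I \<and> v \<in> I \<and> u \<noteq> v \<and> R u v} = Sigma I ?N" by auto
  then have eq: "card {(u, v). u \<in> I \<and> v \<in> I \<and> u \<noteq> v \<and> R u v} = (\<Sum>u\<in>I. card (?N u))"
    using fin by simp
  have "card (I - ?J) * D = (\<Sum>u\<in>I - ?J. D)" by simp
  also have "\<dots> \<le> (\<Sum>u\<in>I - ?J. card (?N u))" by (intro sum_mono) auto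
  also have "\<dots> \<le> (\<Sum>u\<in>I. card (?N u))" using fin by (intro sum_mono2) auto
  finally have "card (I - ?J) * D \<le> card {(u, v). u \<in> I \<and> v \<in> I \<and> u \<noteq> v \<and> R u v}"
    unfolding eq .
  then have 1: "real (card (I - ?J)) * real D \<le> real (card {(u, v). u \<in> I \<and> v \<in> I \<and> u \<noteq> v \<and> R u v})"
    by (simp only: of_nat_mult[symmetric] of_nat_le_iff)
  \<comment> \<open>Rounding down in \<open>D\<close> loses at most a factor 2, because
    \<open>D\<close> is positive: \<open>?n < 2 * r * D + 2 * r \<le> 4 * r * D\<close>.\<close>
  have "?n = 2 * r * D + ?n mod (2 * r)" unfolding D_def by simp
  moreover have "?n mod (2 * r) < 2 * r" using r by simp
  moreover have "2 * r * 1 \<le> 2 * r * D" using D0 by (intro mult_left_mono) auto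
  ultimately have "?n \<le> 4 * r * D" by linarith
  then have "real ?n \<le> real (4 * r * D)" by (simp only: of_nat_le_iff)
  then have D: "real ?n / (4 * real r) \<le> real D" using r by (simp add: field_simps)
  have "real ?n / 2 * (real ?n / (4 * real r)) \<le> real (card (I - ?J)) * real D"
    using half D by (intro mult_mono) auto
  then show ?thesis using 1 by (simp add: power2_eq_square)
qed

section \<open>Random graphs with a given number of edges\<close>

text \<open>Drawing \<open>m\<close> of \<open>M\<close> objects without replacement avoids
  \<open>b\<close> marked ones at most as often as drawing with replacement. It is multiplied out to
  stay free of division.\<close>

lemma binomial_avoid_le:
  fixes M b m :: nat
  assumes "b \<le> M"
  shows "real ((M - b) choose m) * real M ^ m \<le> real (M choose m) * real (M - b) ^ m"
proof (induction m)
  case (Suc m)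
  have step: "real (Suc m) * real (n choose Suc m) = real (n choose m) * real (n - m)" for n
  proof -
    have "Suc m * (n choose Suc m) = (n choose m) * (n - m)"
      using binomial_absorption[of m n] binomial_absorb_comp[of n m] by (simp add: mult.commute)
    then show ?thesis by (simp only: of_nat_mult[symmetric])
  qed
  \<comment> \<open>The next draw. The difference of the two sides is \<open>b * m\<close> as long
    as \<open>m \<le> M - b\<close>; beyond that, truncated subtraction makes the left side
    0.\<close>
  have ineq: "real (M - b - m) * real M \<le> real (M - b) * real (M - m)"
  proof (cases "m \<le> M - b")
    case True
    then have "real (M - b) * real (M - m) - real (M - b - m) * real M = real b * real m"
      using assms by (simp add: of_nat_diff algebra_simps)
    then show ?thesis by (smt (verit) mult_nonneg_nonneg of_nat_0_le_iff)
  qed simp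
  have "real (Suc m) * (real ((M - b) choose Suc m) * real M ^ Suc m)
    = (real ((M - b) choose m) * real M ^ m) * (real (M - b - m) * real M)"
    using step[of "M - b"] by (simp add: mult_ac)
  also have "\<dots> \<le> (real (M choose m) * real (M - b) ^ m) * (real (M - b) * real (M - m))"
    by (rule mult_mono[OF Suc.IH ineq]) simp_all
  also have "\<dots> = real (Suc m) * (real (M choose Suc m) * real (M - b) ^ Suc m)"
    using step[of M] by (simp add: mult_ac)
  finally show ?case by (rule mult_left_le_imp_le) simp
qed simp

lemma finite_pairs: "finite V \<Longrightarrow> finite (pairs V)"
  by (rule finite_subset[of _ "Pow V"]) auto

lemma graphs_with_edges_eq:
  assumes "0 < t"
  shows "graphs_with_edges t m = Pair {1..t} ` {E. E \<subseteq> pairs {1..t} \<and> card E = m}"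
proof (rule set_eqI)
  fix H :: "nat sgraph"
  obtain V E where H: "H = (V, E)" by (cases H)
  have "V = {1..t} \<Longrightarrow> finite V \<and> V \<noteq> {}" using assms by simp
  then have "H \<in> graphs_with_edges t m \<longleftrightarrow> V = {1..t} \<and> E \<subseteq> pairs {1..t} \<and> card E = m"
    unfolding H graphs_with_edges_def simple_graph_def by auto
  then show "H \<in> graphs_with_edges t m \<longleftrightarrow> H \<in> Pair {1..t} ` {E. E \<subseteq> pairs {1..t} \<and> card E = m}"
    unfolding H by (simp add: image_iff)
qed

lemma card_graphs_with_edges:
  assumes "0 < t"
  shows "card (graphs_with_edges t m) = (t choose 2) choose m"
proof -
  have "inj_on (Pair {1..t}) A" for A :: "nat set set set" by (simp add: inj_on_def)
  moreover have "finite (pairs {1..t})" by (simp add: finite_pairs)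
  moreover have "card (pairs {1..t}) = t choose 2" using n_subsets[of "{1..t}" 2] by simp
  ultimately show ?thesis
    unfolding graphs_with_edges_eq[OF assms] using n_subsets[of "pairs {1..t}" m]
    by (simp only: card_image)
qed

lemma graphs_with_edges_finite_nonempty:
  assumes "0 < t" "m \<le> t choose 2"
  shows "finite (graphs_with_edges t m)" "graphs_with_edges t m \<noteq> {}"
proof -
  have "0 < card (graphs_with_edges t m)" using assms by (simp add: card_graphs_with_edges)
  then show "finite (graphs_with_edges t m)" "graphs_with_edges t m \<noteq> {}"
    unfolding card_gt_0_iff by blast+
qed

lemma set_pmf_random_graph:
  "0 < t \<Longrightarrow> m \<le> t choose 2 \<Longrightarrow> set_pmf (random_graph t m) = graphs_with_edges t m"
  unfolding random_graph_def by (intro set_pmf_of_set graphs_with_edges_finite_nonempty)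

text \<open>The edge set is a uniform \<open>m\<close>-subset of all pairs, so the probability is a
  quotient of two binomial coefficients, to which the comparison with independent draws
  applies.\<close>

lemma random_graph_avoids:
  assumes t: "0 < t" and m: "m \<le> t choose 2" and B: "B \<subseteq> pairs {1..t}"
  shows "measure_pmf.prob (random_graph t m) {H. edges H \<inter> B = {}}
    \<le> (1 - real (card B) / real (t choose 2)) ^ m"
proof -
  let ?P = "pairs {1..t}" and ?M = "t choose 2"
  have finP: "finite ?P" by (simp add: finite_pairs)
  have cardP: "card ?P = ?M" using n_subsets[of "{1..t}" 2] by simp
  have bM: "card B \<le> ?M" using card_mono[OF finP B] cardP by simp
  have inj: "inj_on (Pair {1..t}) A" for A :: "nat set set set" by (simp add: inj_on_def)
  note fin = graphs_with_edges_finite_nonempty[OF t m]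
  have eq: "graphs_with_edges t m \<inter> {H. edges H \<inter> B = {}}
      = Pair {1..t} ` {E. E \<subseteq> ?P - B \<and> card E = m}"
    unfolding graphs_with_edges_eq[OF t]
  proof (rule set_eqI)
    fix H :: "nat sgraph"
    obtain V E where H: "H = (V, E)" by (cases H)
    have "E \<subseteq> ?P - B \<longleftrightarrow> E \<subseteq> ?P \<and> E \<inter> B = {}" by blast
    then show "H \<in> Pair {1..t} ` {E. E \<subseteq> ?P \<and> card E = m} \<inter> {H. edges H \<inter> B = {}} \<longleftrightarrow>
        H \<in> Pair {1..t} ` {E. E \<subseteq> ?P - B \<and> card E = m}"
      unfolding H Int_iff image_iff mem_Collect_eq by auto
  qed
  have "card (?P - B) = ?M - card B"
    using cardP card_Diff_subset[OF finite_subset[OF B finP] B] by simp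
  then have "card (graphs_with_edges t m \<inter> {H. edges H \<inter> B = {}}) = (?M - card B) choose m"
    unfolding eq card_image[OF inj] using n_subsets[of "?P - B" m] finP by simp
  then have "measure_pmf.prob (random_graph t m) {H. edges H \<inter> B = {}}
      = real ((?M - card B) choose m) / real (?M choose m)"
    unfolding random_graph_def measure_pmf_of_set[OF fin(2,1)] by (simp add: card_graphs_with_edges[OF t])
  also have "\<dots> \<le> (1 - real (card B) / real ?M) ^ m"
  proof (cases "?M = 0")
    case True
    then have "m = 0" using m by linarith
    then show ?thesis by simp
  next
    case False
    then have "1 - real (card B) / real ?M = real (?M - card B) / real ?M"
      using bM by (simp add: of_nat_diff field_simps)
    then have rhs: "(1 - real (card B) / real ?M) ^ m = real (?M - card B) ^ m / real ?M ^ m"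
      by (simp add: power_divide)
    have pos: "0 < real (?M choose m)" "0 < real ?M ^ m" using m False by simp_all
    have "real ((?M - card B) choose m) \<le> real (?M - card B) ^ m / real ?M ^ m * real (?M choose m)"
      unfolding times_divide_eq_left pos_le_divide_eq[OF pos(2)]
      using binomial_avoid_le[OF bM, of m] by (simp only: mult.commute)
    then show ?thesis unfolding rhs pos_divide_le_eq[OF pos(1)] .
  qed
  finally show ?thesis .
qed

section \<open>Minors of blow-ups\<close>

text \<open>Vertex \<open>x\<close> is copy number \<open>x div N\<close> of the base vertex
  \<open>x mod N\<close>. When \<open>E\<close> consists of pairs, copies of the same base vertex
  are nonadjacent.\<close>

definition blowup :: "nat \<Rightarrow> nat \<Rightarrow> nat set set \<Rightarrow> nat sgraph" where
  "blowup N k E = ({..<N * k}, {{x, y} | x y. x < N * k \<and> y < N * k \<and> {x mod N, y mod N} \<in> E})"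

lemma blowup_edge_iff:
  "{x, y} \<in> edges (blowup N k E) \<longleftrightarrow> x < N * k \<and> y < N * k \<and> {x mod N, y mod N} \<in> E"
  by (auto simp: blowup_def doubleton_eq_iff insert_commute)

lemma simple_graph_blowup:
  assumes "0 < N" "0 < k" "E \<subseteq> pairs {..<N}"
  shows "simple_graph (blowup N k E)"
proof -
  have ne: "x \<noteq> y" if "{x mod N, y mod N} \<in> E" for x y
    using that assms(3) by auto
  show ?thesis
    unfolding simple_graph_def
  proof (intro conjI ballI)
    fix e assume "e \<in> edges (blowup N k E)"
    then obtain x y where xy: "e = {x, y}" "x < N * k" "y < N * k" "{x mod N, y mod N} \<in> E"
      by (auto simp: blowup_def)
    then show "e \<subseteq> verts (blowup N k E)" by (simp add: blowup_def)
    show "card e = 2" using ne[OF xy(4)] xy(1) by simp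
  qed (use assms in \<open>simp_all add: blowup_def lessThan_empty_iff\<close>)
qed

text \<open>An ordered edge of the blow-up is an ordered base edge together with two copy numbers,
  which can be chosen freely.\<close>

lemma card_blowup_ordered:
  assumes N: "0 < N" and E: "E \<subseteq> pairs {..<N}"
  shows "card {(x, y). {x, y} \<in> edges (blowup N k E)} = card {(a, b). {a, b} \<in> E} * (k * k)"
proof -
  let ?f = "\<lambda>((a, b), (i, j)). (a + N * i, b + N * j)"
  let ?g = "\<lambda>(x, y). ((x mod N, y mod N), (x div N, y div N))"
  have ltN: "a < N" "b < N" if "{a, b} \<in> E" for a b using that E by auto
  have lt: "a + N * i < N * k" if "a < N" "i < k" for a i
  proof -
    have "a + N * i < N + N * i" using that by simp
    also have "\<dots> = N * Suc i" by simp
    also have "\<dots> \<le> N * k" using that by (intro mult_left_mono) auto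
    finally show ?thesis .
  qed
  have "bij_betw ?f ({(a, b). {a, b} \<in> E} \<times> ({..<k} \<times> {..<k})) {(x, y). {x, y} \<in> edges (blowup N k E)}"
  proof (rule bij_betw_byWitness[where f' = ?g])
    show "\<forall>a\<in>{(a, b). {a, b} \<in> E} \<times> ({..<k} \<times> {..<k}). ?g (?f a) = a"
      using ltN N by auto
    show "\<forall>a'\<in>{(x, y). {x, y} \<in> edges (blowup N k E)}. ?f (?g a') = a'"
      by auto
    show "?f ` ({(a, b). {a, b} \<in> E} \<times> ({..<k} \<times> {..<k})) \<subseteq> {(x, y). {x, y} \<in> edges (blowup N k E)}"
      using ltN lt by (auto simp: blowup_edge_iff)
    show "?g ` {(x, y). {x, y} \<in> edges (blowup N k E)} \<subseteq> {(a, b). {a, b} \<in> E} \<times> ({..<k} \<times> {..<k})"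
      using N by (auto simp: blowup_edge_iff less_mult_imp_div_less mult.commute)
  qed
  from bij_betw_same_card[OF this] show ?thesis by (simp add: card_cartesian_product)
qed

lemma average_degree_blowup:
  assumes "0 < N" "0 < k" "E \<subseteq> pairs {..<N}"
  shows "average_degree (blowup N k E) = 2 * real k * real (card E) / real N"
proof -
  let ?G = "blowup N k E"
  have G: "simple_graph ?G" using assms by (rule simple_graph_blowup)
  have "finite E" using assms(3) finite_pairs[of "{..<N}"] finite_subset by blast
  then have "card {(a, b). {a, b} \<in> E} = 2 * card E"
    using assms(3) by (intro card_ordered_pairs) auto
  moreover have "card {(x, y). {x, y} \<in> edges ?G} = 2 * card (edges ?G)"
    using simple_graph_edgeD(2)[OF G] finite_edges[OF G] by (intro card_ordered_pairs) auto
  ultimately have "card (edges ?G) = card E * (k * k)"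
    using card_blowup_ordered[OF assms(1,3), of k] by simp
  then show ?thesis
    unfolding average_degree_eq[OF G] using assms(1,2) by (simp add: blowup_def)
qed

section \<open>Traces of branch sets on the base graph\<close>

definition live :: "nat \<Rightarrow> (nat \<Rightarrow> nat set) \<Rightarrow> nat set" where
  "live t W = {v \<in> {1..t}. W v \<noteq> {}}"

text \<open>These pairs are forbidden as edges of a minor whose branch sets leave the traces
  \<open>W\<close>; vertices with a large branch set forbid nothing.\<close>

definition nonadjacent_pairs :: "nat set set \<Rightarrow> nat \<Rightarrow> (nat \<Rightarrow> nat set) \<Rightarrow> nat set set" where
  "nonadjacent_pairs E t W =
    {{u, v} | u v. u \<in> live t W \<and> v \<in> live t W \<and> u \<noteq> v \<and> \<not> adjacent_in E (W u) (W v)}"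

text \<open>The traces on the base graph of the small branch sets of a minor on \<open>{1..t}\<close>; a large
  branch set is recorded as \<open>{}\<close>.\<close>

definition configurations :: "nat \<Rightarrow> nat \<Rightarrow> nat \<Rightarrow> nat \<Rightarrow> (nat \<Rightarrow> nat set) set" where
  "configurations N k s t = {W \<in> {1..t} \<rightarrow>\<^sub>E {X. X \<subseteq> {..<N} \<and> card X \<le> s}.
     (\<forall>x<N. card {v \<in> {1..t}. x \<in> W v} \<le> k) \<and> (t - card (live t W)) * (s + 1) \<le> N * k}"

lemma live_subset: "live t W \<subseteq> {1..t}" and finite_live: "finite (live t W)"
  by (auto simp: live_def)

lemma nonadjacent_pairs_subset: "nonadjacent_pairs E t W \<subseteq> pairs {1..t}"
  using live_subset[of t W] by (auto simp: nonadjacent_pairs_def)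

text \<open>Only traces are counted, so the bound does not involve \<open>k\<close>. This is the
  gain from blowing up when \<open>t\<close> is large compared with \<open>d\<close>.\<close>

lemma card_configurations_le: "card (configurations N k s t) \<le> ((N + 1) ^ s) ^ t"
proof -
  let ?X = "{X. X \<subseteq> {..<N} \<and> card X \<le> s}"
  have "card (configurations N k s t) \<le> card ({1..t} \<rightarrow>\<^sub>E ?X)"
    using finite_small_subsets by (intro card_mono finite_PiE) (auto simp: configurations_def)
  also have "\<dots> = card ?X ^ t" by (simp add: card_PiE)
  also have "\<dots> \<le> ((N + 1) ^ s) ^ t" using card_small_subsets_le by (intro power_mono) auto
  finally show ?thesis .
qed

lemma finite_configurations: "finite (configurations N k s t)"
proof (rule finite_subset)
  show "configurations N k s t \<subseteq> {1..t} \<rightarrow>\<^sub>E {X. X \<subseteq> {..<N} \<and> card X \<le> s}"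
    by (auto simp: configurations_def)
  show "finite ({1..t} \<rightarrow>\<^sub>E {X. X \<subseteq> {..<N} \<and> card X \<le> s})"
    using finite_small_subsets by (intro finite_PiE) auto
qed

text \<open>Disjoint branch sets may have overlapping traces, while the base graph only controls
  disjoint systems. Each of the at most \<open>s\<close> points of a trace lies in at most
  \<open>k - 1\<close> others, which bounds the exceptions.\<close>

lemma card_overlapping_pairs_le:
  assumes W: "W \<in> configurations N k s t"
  shows "card {(u, v). u \<in> live t W \<and> v \<in> live t W \<and> u \<noteq> v \<and> W u \<inter> W v \<noteq> {}}
    \<le> card (live t W) * (s * (k - 1))"
proof -
  let ?I = "live t W"
  let ?O = "\<lambda>u x. {v \<in> {1..t}. x \<in> W v} - {u}"
  have Wu: "W u \<subseteq> {..<N}" "card (W u) \<le> s" "finite (W u)" if "u \<in> ?I" for u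
  proof -
    have "u \<in> {1..t}" using that live_subset by blast
    then show "W u \<subseteq> {..<N}" "card (W u) \<le> s" using W by (auto simp: configurations_def PiE_iff)
    then show "finite (W u)" using finite_subset by blast
  qed
  have O: "card (?O u x) \<le> k - 1" if "u \<in> ?I" "x \<in> W u" for u x
  proof -
    have "u \<in> {v \<in> {1..t}. x \<in> W v}" using that live_subset by blast
    moreover have "card {v \<in> {1..t}. x \<in> W v} \<le> k"
      using W Wu(1)[OF that(1)] that(2) by (auto simp: configurations_def)
    ultimately show ?thesis by simp
  qed
  have "{(u, v). u \<in> ?I \<and> v \<in> ?I \<and> u \<noteq> v \<and> W u \<inter> W v \<noteq> {}}
      \<subseteq> Sigma ?I (\<lambda>u. \<Union>x\<in>W u. ?O u x)"
    using live_subset[of t W] by blast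
  then have "card {(u, v). u \<in> ?I \<and> v \<in> ?I \<and> u \<noteq> v \<and> W u \<inter> W v \<noteq> {}}
      \<le> card (Sigma ?I (\<lambda>u. \<Union>x\<in>W u. ?O u x))"
    using finite_live Wu(3) by (intro card_mono finite_SigmaI finite_UN_I) auto
  also have "\<dots> = (\<Sum>u\<in>?I. card (\<Union>x\<in>W u. ?O u x))"
    using finite_live Wu(3) by (intro card_SigmaI ballI finite_UN_I) auto
  also have "\<dots> \<le> (\<Sum>u\<in>?I. s * (k - 1))"
  proof (rule sum_mono)
    fix u assume u: "u \<in> ?I"
    have "card (\<Union>x\<in>W u. ?O u x) \<le> (\<Sum>x\<in>W u. card (?O u x))"
      using Wu(3)[OF u] by (rule card_UN_le)
    also have "\<dots> \<le> (\<Sum>x\<in>W u. k - 1)" using O[OF u] by (rule sum_mono)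
    also have "\<dots> \<le> s * (k - 1)" using Wu(2)[OF u] by simp
    finally show "card (\<Union>x\<in>W u. ?O u x) \<le> s * (k - 1)" .
  qed
  finally show ?thesis by simp
qed

text \<open>Call two live vertices related if their traces are nonadjacent or overlap. Pairwise
  unrelated live vertices, \<open>r\<close> in number, would form a clique of small sets, so many
  pairs are related. Removing the overlapping ones and halving, as ordered pairs were counted, gives
  the bound.\<close>

lemma card_nonadjacent_pairs_ge:
  assumes W: "W \<in> configurations N k s t" and r: "0 < r" "4 * r \<le> card (live t W)"
    and host: "\<And>W. \<not> clique_of_small_sets N s r E W"
  shows "(real (card (live t W)))\<^sup>2 / (16 * real r)
    - real (card (live t W)) * real (s * (k - 1)) / 2 \<le> real (card (nonadjacent_pairs E t W))"
proof -
  let ?I = "live t W" and ?B = "nonadjacent_pairs E t W"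
  let ?R = "\<lambda>u v. \<not> adjacent_in E (W u) (W v) \<or> W u \<inter> W v \<noteq> {}"
  let ?RR = "{(u, v). u \<in> ?I \<and> v \<in> ?I \<and> u \<noteq> v \<and> ?R u v}"
  let ?BB = "{(u, v). {u, v} \<in> ?B}"
  let ?OO = "{(u, v). u \<in> ?I \<and> v \<in> ?I \<and> u \<noteq> v \<and> W u \<inter> W v \<noteq> {}}"
  have WX: "W u \<in> {X. X \<subseteq> {..<N} \<and> card X \<le> s}" if "u \<in> ?I" for u
  proof -
    have "u \<in> {1..t}" using that live_subset by blast
    then show ?thesis using W by (auto simp: configurations_def PiE_iff)
  qed
  have "(real (card ?I))\<^sup>2 / (8 * real r) \<le> real (card ?RR)"
  proof (rule many_related_pairs[OF finite_live _ r])
    show "?R v u" if "?R u v" for u v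
      using that adjacent_in_commute[of E "W u" "W v"] by (simp add: Int_commute)
  next
    fix X assume X: "X \<subseteq> ?I" "card X = r"
    then have "finite X" using finite_live finite_subset by blast
    then obtain h where h: "bij_betw h {0..<r} X" using ex_bij_betw_nat_finite X(2) by blast
    have hX: "h i \<in> X" if "i < r" for i using bij_betwE[OF h] that by simp
    have inj: "h i \<noteq> h j" if "i < r" "j < r" "i \<noteq> j" for i j
      using bij_betw_imp_inj_on[OF h] that by (auto dest: inj_onD)
    show "\<exists>u\<in>X. \<exists>v\<in>X. u \<noteq> v \<and> ?R u v"
    proof (rule ccontr)
      assume none: "\<not> ?thesis"
      let ?W = "\<lambda>i\<in>{..<r}. W (h i)"
      have none': "adjacent_in E (W (h i)) (W (h j)) \<and> W (h i) \<inter> W (h j) = {}"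
        if "i < r" "j < r" "i \<noteq> j" for i j
        using none hX[OF that(1)] hX[OF that(2)] inj[OF that] by blast
      have "W (h i) \<in> {X. X \<subseteq> {..<N} \<and> card X \<le> s}" if "i < r" for i
        using WX hX[OF that] X(1) by blast
      then have "?W \<in> {..<r} \<rightarrow>\<^sub>E {X. X \<subseteq> {..<N} \<and> card X \<le> s}" by simp
      moreover have "disjoint_family_on ?W {..<r}"
        using none' by (simp add: disjoint_family_on_def)
      moreover have "\<forall>i<r. \<forall>j<i. adjacent_in E (?W i) (?W j)"
        using none' by simp
      ultimately show False using host unfolding clique_of_small_sets_def by blast
    qed
  qed
  also have "card ?RR \<le> card ?BB + card ?OO"
  proof (rule order_trans[OF card_mono card_Un_le])
    have "?BB \<subseteq> {1..t} \<times> {1..t}" using nonadjacent_pairs_subset[of E t W] by auto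
    moreover have "?OO \<subseteq> ?I \<times> ?I" by blast
    ultimately show "finite (?BB \<union> ?OO)"
      using finite_live by (meson finite_SigmaI finite_UnI finite_atLeastAtMost finite_subset)
    show "?RR \<subseteq> ?BB \<union> ?OO" unfolding nonadjacent_pairs_def by blast
  qed
  also have "card ?BB = 2 * card ?B"
    using nonadjacent_pairs_subset[of E t W] finite_subset[OF nonadjacent_pairs_subset finite_pairs]
    by (intro card_ordered_pairs) auto
  finally have "(real (card ?I))\<^sup>2 / (8 * real r) \<le> real (2 * card ?B + card ?OO)" by simp
  also have "\<dots> \<le> real (2 * card ?B + card ?I * (s * (k - 1)))"
    by (intro of_nat_mono add_left_mono card_overlapping_pairs_le[OF W])
  also have "\<dots> = 2 * real (card ?B) + real (card ?I) * real (s * (k - 1))"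
    by (simp only: of_nat_add of_nat_mult of_nat_numeral)
  finally have "(real (card ?I))\<^sup>2 / (8 * real r) \<le> 2 * real (card ?B) + real (card ?I) * real (s * (k - 1))" .
  moreover have "(real (card ?I))\<^sup>2 / (16 * real r) = (real (card ?I))\<^sup>2 / (8 * real r) / 2" by simp
  ultimately show ?thesis by linarith
qed

text \<open>Reduction modulo \<open>N\<close> sends adjacent branch sets to adjacent traces, so an
  edge of \<open>H\<close> between live vertices never joins nonadjacent traces.\<close>

lemma is_minor_blowup_configuration:
  assumes N: "0 < N" and k: "0 < k" and minor: "is_minor H (blowup N k E)" and H: "verts H = {1..t}"
  shows "\<exists>W\<in>configurations N k s t. edges H \<inter> nonadjacent_pairs E t W = {}"
proof -
  obtain B where B: "\<forall>v\<in>verts H. B v \<noteq> {} \<and> B v \<subseteq> verts (blowup N k E)"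
    "disjoint_family_on B (verts H)"
    "\<forall>u v. {u, v} \<in> edges H \<longrightarrow> (\<exists>a\<in>B u. \<exists>b\<in>B v. {a, b} \<in> edges (blowup N k E))"
    using is_minor_branch_sets[OF minor] by (elim exE conjE) (rule that)
  have Bv: "B v \<noteq> {}" "B v \<subseteq> {..<N * k}" "finite (B v)" if "v \<in> {1..t}" for v
  proof -
    show "B v \<noteq> {}" "B v \<subseteq> {..<N * k}" using B(1) that unfolding H by (simp_all add: blowup_def)
    then show "finite (B v)" using finite_subset by blast
  qed
  define U where "U v = (\<lambda>a. a mod N) ` B v" for v
  define W where "W = (\<lambda>v\<in>{1..t}. if card (U v) \<le> s then U v else {})"
  have WU: "W v = U v" if "v \<in> live t W" for v
    using that by (auto simp: live_def W_def split: if_splits)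
  \<comment> \<open>Branch sets are nonempty, so \<open>W v\<close> can be empty only because the
    trace has more than \<open>s\<close> points, and the branch set is at least as large as its
    trace.\<close>
  have large: "s + 1 \<le> card (B v)" if "v \<in> {1..t}" "v \<notin> live t W" for v
  proof -
    have "W v = {}" using that by (simp add: live_def)
    moreover have "U v \<noteq> {}" using Bv(1)[OF that(1)] by (simp add: U_def)
    ultimately have "s < card (U v)" using that(1) by (auto simp: W_def split: if_splits)
    also have "\<dots> \<le> card (B v)" unfolding U_def using Bv(3)[OF that(1)] by (rule card_image_le)
    finally show ?thesis by simp
  qed
  have disj: "B u \<inter> B v = {}" if "u \<in> {1..t}" "v \<in> {1..t}" "u \<noteq> v" for u v
    using B(2) that unfolding H disjoint_family_on_def by blast
  have "card (W v) \<le> s" "W v \<subseteq> {..<N}" if "v \<in> {1..t}" for v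
    using that N by (auto simp: W_def U_def)
  then have "W \<in> {1..t} \<rightarrow>\<^sub>E {X. X \<subseteq> {..<N} \<and> card X \<le> s}" by (auto simp: W_def)
  \<comment> \<open>Every such \<open>v\<close> occupies at least one of the \<open>k\<close> copies
    of \<open>x\<close>, and disjoint branch sets occupy different copies.\<close>
  moreover have "card {v \<in> {1..t}. x \<in> W v} \<le> k" if x: "x < N" for x
  proof -
    let ?V = "{v \<in> {1..t}. x \<in> W v}" and ?F = "\<lambda>v. {a \<in> B v. a mod N = x}"
    have "1 \<le> card (?F v)" if "v \<in> ?V" for v
    proof -
      have "x \<in> U v" using that by (auto simp: W_def split: if_splits)
      then have "?F v \<noteq> {}" by (auto simp: U_def)
      moreover have "finite (?F v)" using Bv(3) that by simp
      ultimately show ?thesis by (simp add: Suc_le_eq card_gt_0_iff)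
    qed
    then have "(\<Sum>v\<in>?V. 1) \<le> (\<Sum>v\<in>?V. card (?F v))" by (rule sum_mono)
    also have "\<dots> = card (\<Union>v\<in>?V. ?F v)"
    proof (intro card_UN_disjoint[symmetric] ballI impI)
      fix u v assume "u \<in> ?V" "v \<in> ?V" "u \<noteq> v"
      then show "?F u \<inter> ?F v = {}" using disj[of u v] by blast
    qed (use Bv(3) in simp_all)
    also have "\<dots> \<le> card ((\<lambda>i. x + N * i) ` {..<k})"
    proof (rule card_mono)
      show "(\<Union>v\<in>?V. ?F v) \<subseteq> (\<lambda>i. x + N * i) ` {..<k}"
      proof
        fix a assume "a \<in> (\<Union>v\<in>?V. ?F v)"
        then have a: "a < N * k" "a mod N = x" using Bv(2) by fastforce+
        then have "a = x + N * (a div N)" "a div N < k"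
          using N by (auto simp: less_mult_imp_div_less mult.commute)
        then show "a \<in> (\<lambda>i. x + N * i) ` {..<k}" by blast
      qed
    qed simp
    also have "\<dots> \<le> k" using card_image_le[of "{..<k}"] by simp
    finally show ?thesis by simp
  qed
  \<comment> \<open>The discarded branch sets are disjoint and each takes at least
    \<open>s + 1\<close> of the \<open>N * k\<close> vertices.\<close>
  moreover have "(t - card (live t W)) * (s + 1) \<le> N * k"
  proof -
    let ?L = "{1..t} - live t W"
    have "card ?L = t - card (live t W)"
      using card_Diff_subset[OF finite_live live_subset] by simp
    then have "(t - card (live t W)) * (s + 1) = (\<Sum>v\<in>?L. s + 1)" by simp
    also have "\<dots> \<le> (\<Sum>v\<in>?L. card (B v))" using large by (intro sum_mono) auto
    also have "\<dots> = card (\<Union>v\<in>?L. B v)"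
      using disj Bv(3) by (intro card_UN_disjoint[symmetric] ballI impI) simp_all
    also have "\<dots> \<le> card {..<N * k}" using Bv(2) by (intro card_mono) blast+
    finally show ?thesis by simp
  qed
  ultimately have "W \<in> configurations N k s t" by (simp add: configurations_def)
  moreover have "e \<notin> nonadjacent_pairs E t W" if e: "e \<in> edges H" for e
  proof
    assume "e \<in> nonadjacent_pairs E t W"
    then obtain u v where uv: "e = {u, v}" "u \<in> live t W" "v \<in> live t W"
      "\<not> adjacent_in E (W u) (W v)" by (auto simp: nonadjacent_pairs_def)
    obtain a b where ab: "a \<in> B u" "b \<in> B v" "{a, b} \<in> edges (blowup N k E)"
      using B(3) e uv(1) by blast
    then have "{a mod N, b mod N} \<in> E" by (simp add: blowup_edge_iff)
    then have "adjacent_in E (U u) (U v)" using ab by (auto simp: adjacent_in_def U_def)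
    then show False using uv WU by simp
  qed
  ultimately show ?thesis by blast
qed

lemma one_minus_power_le_exp:
  fixes y :: real
  assumes "y \<le> 1" shows "(1 - y) ^ m \<le> exp (- (real m * y))"
proof -
  have "(1 - y) ^ m \<le> exp (- y) ^ m"
    using assms exp_ge_add_one_self[of "- y"] by (intro power_mono) auto
  then show ?thesis by (simp add: exp_of_nat_mult[symmetric])
qed

text \<open>Union bound over the configurations: \<open>H\<close> can be a minor only if it avoids
  all nonadjacent pairs of some configuration.\<close>

lemma prob_minor_blowup_le:
  fixes b :: real
  assumes N: "0 < N" and k: "0 < k" and t: "2 \<le> t" and m: "m \<le> t choose 2"
    and bad: "\<And>W. W \<in> configurations N k s t \<Longrightarrow> b \<le> real (card (nonadjacent_pairs E t W))"
  shows "measure_pmf.prob (random_graph t m) {H. is_minor H (blowup N k E)}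
    \<le> real (((N + 1) ^ s) ^ t) * exp (- (real m * (b / real (t choose 2))))"
proof -
  let ?P = "measure_pmf.prob (random_graph t m)" and ?M = "real (t choose 2)"
  let ?C = "configurations N k s t" and ?A = "\<lambda>W. {H. edges H \<inter> nonadjacent_pairs E t W = {}}"
  have t0: "0 < t" using t by simp
  have M: "0 < ?M" using t by simp
  \<comment> \<open>Passing to the support provides \<open>verts H = {1..t}\<close>.\<close>
  have "?P {H. is_minor H (blowup N k E)}
      = ?P ({H. is_minor H (blowup N k E)} \<inter> set_pmf (random_graph t m))"
    by (rule measure_Int_set_pmf[symmetric])
  also have "\<dots> \<le> ?P (\<Union>W\<in>?C. ?A W)"
  proof (rule measure_pmf.finite_measure_mono)
    show "{H. is_minor H (blowup N k E)} \<inter> set_pmf (random_graph t m) \<subseteq> (\<Union>W\<in>?C. ?A W)"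
      using is_minor_blowup_configuration[OF N k]
      unfolding set_pmf_random_graph[OF t0 m] by (auto simp: graphs_with_edges_def)
  qed simp
  also have "\<dots> \<le> (\<Sum>W\<in>?C. ?P (?A W))"
    using finite_configurations by (intro measure_pmf.finite_measure_subadditive_finite) auto
  also have "\<dots> \<le> (\<Sum>W\<in>?C. exp (- (real m * (b / ?M))))"
  proof (rule sum_mono)
    fix W assume W: "W \<in> ?C"
    let ?B = "nonadjacent_pairs E t W"
    have "card ?B \<le> t choose 2"
      using card_mono[OF finite_pairs nonadjacent_pairs_subset[of E t W]] n_subsets[of "{1..t}" 2] by simp
    then have le1: "real (card ?B) / ?M \<le> 1" using M by (simp add: divide_le_eq_1)
    have "?P (?A W) \<le> (1 - real (card ?B) / ?M) ^ m"
      using t0 m nonadjacent_pairs_subset by (rule random_graph_avoids)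
    also have "\<dots> \<le> exp (- (real m * (real (card ?B) / ?M)))" using le1 by (rule one_minus_power_le_exp)
    also have "\<dots> \<le> exp (- (real m * (b / ?M)))"
      using bad[OF W] M by (simp add: divide_right_mono mult_left_mono)
    finally show "?P (?A W) \<le> exp (- (real m * (b / ?M)))" .
  qed
  also have "\<dots> = real (card ?C) * exp (- (real m * (b / ?M)))" by simp
  also have "\<dots> \<le> real (((N + 1) ^ s) ^ t) * exp (- (real m * (b / ?M)))"
    using card_configurations_le by (intro mult_right_mono) (simp_all only: of_nat_le_iff exp_ge_zero)
  finally show ?thesis .
qed

section \<open>Choice of parameters\<close>

text \<open>The conditions say in turn: rounding by \<open>k\<close> is negligible; the base graph
  has at most \<open>d ^ 4\<close> vertices; its union bound over cliques succeeds; \<open>r\<close>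
  is small against the number of live vertices; overlaps are negligible; the union bound over
  configurations yields \<open>c ^ t\<close>. In each, powers of \<open>d\<close> beat logarithmic
  factors.\<close>

lemma eventually_parameters:
  fixes x \<delta> p c :: real
  assumes x: "0 < x" and \<delta>: "0 < \<delta>" "\<delta> < 1" and p: "0 < p" and c: "0 < c"
  defines "S \<equiv> \<lambda>d. sqrt (ln d / x)" and "R \<equiv> \<lambda>d. d powr (1 - \<delta>) + 2"
  shows "eventually (\<lambda>d::real. 4 / d \<le> \<delta> * (1 - \<delta>)\<^sup>2 * S d \<and> S d * d ^ 3 + 1 \<le> d ^ 4 \<and>
    4 * S d * ln d - d powr (\<delta> * (1 - \<delta>)) / 2 < ln (\<delta> * p) \<and> 4 * R d \<le> \<delta> * d \<and>
    S d / d ^ 3 \<le> \<delta> / (16 * R d) \<and>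
    4 * S d * ln d - \<delta>\<^sup>2 * d / (64 * R d) < ln c \<and> 4 \<le> d) at_top"
proof -
  \<comment> \<open>Opaque constants of known sign let \<open>real_asymp\<close> compare the growth
    rates.\<close>
  define \<gamma> where "\<gamma> = \<delta> * (1 - \<delta>)"
  define \<kappa> where "\<kappa> = \<delta> * (1 - \<delta>)\<^sup>2"
  define \<beta> where "\<beta> = 1 - \<delta>"
  have pos: "0 < \<gamma>" "0 < \<kappa>" "0 < \<beta>" "\<beta> < 1" using \<delta> by (auto simp: \<gamma>_def \<kappa>_def \<beta>_def)
  have 1: "eventually (\<lambda>d::real. 4 / d \<le> \<kappa> * sqrt (ln d / x)) at_top" using x pos by real_asymp
  have 2: "eventually (\<lambda>d::real. sqrt (ln d / x) * d ^ 3 + 1 \<le> d ^ 4) at_top" using x by real_asymp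
  have "filterlim (\<lambda>d. 4 * sqrt (ln d / x) * ln d - d powr \<gamma> / 2) at_bot at_top" using x pos by real_asymp
  then have 3: "eventually (\<lambda>d::real. 4 * sqrt (ln d / x) * ln d - d powr \<gamma> / 2 < ln (\<delta> * p)) at_top"
    by (simp add: filterlim_at_bot_dense)
  have 4: "eventually (\<lambda>d::real. 4 * (d powr \<beta> + 2) \<le> \<delta> * d) at_top" using \<delta>(1) pos by real_asymp
  have 5: "eventually (\<lambda>d::real. sqrt (ln d / x) / d ^ 3 \<le> \<delta> / (16 * (d powr \<beta> + 2))) at_top"
    using x \<delta>(1) pos by real_asymp
  have "filterlim (\<lambda>d. 4 * sqrt (ln d / x) * ln d - \<delta>\<^sup>2 * d / (64 * (d powr \<beta> + 2))) at_bot at_top"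
    using x \<delta>(1) pos by real_asymp
  then have 6: "eventually (\<lambda>d::real. 4 * sqrt (ln d / x) * ln d - \<delta>\<^sup>2 * d / (64 * (d powr \<beta> + 2)) < ln c) at_top"
    by (simp add: filterlim_at_bot_dense)
  show ?thesis
    using 1 2 3 4 5 6 eventually_ge_at_top[of 4] unfolding S_def R_def \<gamma>_def \<kappa>_def \<beta>_def
    by eventually_elim auto
qed

text \<open>Of the four factors \<open>1 - \<delta>\<close> in the degree, two come from the number
  of vertices \<open>N * k\<close>, about \<open>(1 - \<delta>)\<^sup>2 * t * S\<close>, one from
  rounding, and one from the edge deficit \<open>\<delta> * p\<close> of the base graph. With so few
  vertices at most \<open>(1 - \<delta>) * t\<close> branch sets exceed size \<open>s\<close>, so at
  least \<open>\<delta> * t\<close> vertices stay live.\<close>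

lemma exists_blowup:
  fixes x \<delta> p c S R :: real and d t m :: nat
  assumes x: "0 < x" and \<delta>: "0 < \<delta>" "\<delta> < 1" and p: "p = 1 - exp (- x)" and c: "0 < c"
    and S: "S = sqrt (ln (real d) / x)" and R: "R = real d powr (1 - \<delta>) + 2"
    and k_small: "4 / real d \<le> \<delta> * (1 - \<delta>)\<^sup>2 * S"
    and N_small: "S * real d ^ 3 + 1 \<le> real d ^ 4"
    and host: "4 * S * ln (real d) - real d powr (\<delta> * (1 - \<delta>)) / 2 < ln (\<delta> * p)"
    and r_small: "4 * R \<le> \<delta> * real d"
    and overlap: "S / real d ^ 3 \<le> \<delta> / (16 * R)"
    and union: "4 * S * ln (real d) - \<delta>\<^sup>2 * real d / (64 * R) < ln c"
    and d: "4 \<le> real d" and t: "d + 1 \<le> t"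
    and m: "m \<le> t choose 2" "real t * real d / 4 \<le> real m"
  shows "\<exists>G :: nat sgraph. simple_graph G \<and> p * (1 - \<delta>) ^ 4 * real t * S \<le> average_degree G \<and>
    measure_pmf.prob (random_graph t m) {H. is_minor H G} < c ^ t"
proof -
  define s where "s = nat \<lfloor>(1 - \<delta>) * S\<rfloor>"
  \<comment> \<open>The order \<open>t / d ^ 3\<close> keeps \<open>N\<close> polynomial in
    \<open>d\<close>, and \<open>k - 1 \<le> t / d ^ 3\<close> makes overlaps rare. For
    \<open>t < d ^ 3\<close> there is a single copy and no overlap.\<close>
  define k where "k = t div d ^ 3 + 1"
  define N where "N = nat \<lfloor>(1 - \<delta>)\<^sup>2 * real t * S / real k\<rfloor>"
  define r where "r = nat \<lceil>real d powr (1 - \<delta>)\<rceil> + 1"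
  have t0: "0 < real t" "real d \<le> real t" using t by simp_all
  have lnd: "0 < ln (real d)" using d by simp
  have S0: "0 < S" using lnd x by (simp add: S)
  have S2: "x * S\<^sup>2 = ln (real d)" using lnd x by (simp add: S)
  have p01: "0 < p" "p < 1" "1 - p = exp (- x)" using x by (simp_all add: p)
  have R0: "2 \<le> R" by (simp add: R)
  have k0: "0 < real k" by (simp add: k_def)
  have pd: "0 < real d ^ 3" using d by simp
  have div_mod: "real t = real (k - 1) * real d ^ 3 + real (t mod d ^ 3)"
  proof -
    have "t = (k - 1) * d ^ 3 + t mod d ^ 3"
      unfolding k_def using div_mult_mod_eq[of t "d ^ 3"] by simp
    from arg_cong[OF this, of real] show ?thesis by (simp only: of_nat_mult of_nat_add of_nat_power)
  qed
  have k_pred: "real (k - 1) \<le> real t / real d ^ 3"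
    using div_mod pd by (simp add: pos_le_divide_eq)
  have "t mod d ^ 3 < d ^ 3" using d by simp
  then have "real (t mod d ^ 3) < real d ^ 3" by (simp flip: of_nat_power)
  then have "real t \<le> real k * real d ^ 3"
    using div_mod k0 by (simp add: k_def algebra_simps)
  then have k_lower: "real t / real d ^ 3 \<le> real k" using pd by (simp add: pos_divide_le_eq)
  have k_upper: "real k \<le> 2 * real t / real d"
  proof -
    have "real k = real (k - 1) + 1" by (simp add: k_def)
    also have "\<dots> \<le> real t / real d ^ 3 + 1" using k_pred by simp
    also have "real t / real d ^ 3 \<le> real t / real d"
      using d t0 power_increasing[of 1 3 "real d"] by (intro divide_left_mono) auto
    also have "1 \<le> real t / real d" using t0 d by simp
    finally show ?thesis by simp
  qed
  have a0: "0 < (1 - \<delta>)\<^sup>2 * real t * S" using \<delta> t0 S0 by simp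
  have Nk: "real (N * k) \<le> (1 - \<delta>)\<^sup>2 * real t * S"
  proof -
    have "real N \<le> (1 - \<delta>)\<^sup>2 * real t * S / real k" unfolding N_def using a0 by simp
    then show ?thesis using k0 by (simp add: pos_le_divide_eq)
  qed
  have "(1 - \<delta>)\<^sup>2 * real t * S / real k < real N + 1" unfolding N_def by linarith
  then have Nk_lower: "(1 - \<delta>)\<^sup>2 * real t * S - real k < real N * real k"
    using k0 by (simp add: pos_divide_less_eq algebra_simps)
  \<comment> \<open>One \<open>k\<close> is lost to the floor in \<open>N\<close>, another to
    \<open>N - 1\<close> in place of \<open>N\<close>, which comes from \<open>N choose 2\<close>.
    Together they cost one factor \<open>1 - \<delta>\<close>.\<close>
  have main: "(1 - \<delta>) ^ 3 * real t * S \<le> (real N - 1) * real k"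
  proof -
    have "real t * (4 / real d) \<le> real t * (\<delta> * (1 - \<delta>)\<^sup>2 * S)"
      using k_small by (rule mult_left_mono) simp
    moreover have "2 * (2 * real t / real d) = real t * (4 / real d)" by simp
    moreover have "real t * (\<delta> * (1 - \<delta>)\<^sup>2 * S) = \<delta> * (1 - \<delta>)\<^sup>2 * real t * S"
      by (simp only: mult_ac)
    ultimately have "2 * real k \<le> \<delta> * (1 - \<delta>)\<^sup>2 * real t * S" using k_upper by linarith
    moreover have "(1 - \<delta>) ^ 3 * real t * S = (1 - \<delta>)\<^sup>2 * real t * S - \<delta> * (1 - \<delta>)\<^sup>2 * real t * S"
      by (simp add: power3_eq_cube power2_eq_square algebra_simps)
    ultimately show ?thesis using Nk_lower by (simp add: algebra_simps)
  qed
  have "0 < (1 - \<delta>) ^ 3 * real t * S" using \<delta> t0 S0 by simp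
  then have "0 < (real N - 1) * real k" using main by linarith
  then have N2: "2 \<le> N" using k0 by (simp add: zero_less_mult_iff)
  have N_upper: "real (N + 1) \<le> real d ^ 4"
  proof -
    have "(1 - \<delta>)\<^sup>2 \<le> 1" using \<delta> by (simp add: power_le_one)
    then have "(1 - \<delta>)\<^sup>2 * (real t * S) \<le> 1 * (real t * S)" using t0 S0 by (intro mult_right_mono) auto
    then have "real N * real k \<le> real t * S" using Nk by simp
    also have "\<dots> = (real t / real d ^ 3) * (S * real d ^ 3)" using pd by simp
    also have "\<dots> \<le> real k * (S * real d ^ 3)" using k_lower S0 by (intro mult_right_mono) auto
    finally have "real N * real k \<le> (S * real d ^ 3) * real k" by (simp add: mult.commute)
    then have "real N \<le> S * real d ^ 3" using k0 by (rule mult_right_le_imp_le)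
    then show ?thesis using N_small by simp
  qed
  have s_upper: "real s \<le> (1 - \<delta>) * S" unfolding s_def using \<delta> S0 by simp
  have s_lower: "(1 - \<delta>) * S \<le> real (s + 1)" unfolding s_def by linarith
  have s_S: "real s \<le> S" using s_upper \<delta> S0 mult_right_mono[of "1 - \<delta>" 1 S] by linarith
  define Z where "Z = 4 * S * ln (real d)"
  have Z: "real ((N + 1) ^ s) \<le> exp Z"
  proof -
    have "real ((N + 1) ^ s) \<le> (real d ^ 4) ^ s" unfolding of_nat_power using N_upper by (intro power_mono) auto
    also have "real d ^ 4 = exp (4 * ln (real d))"
      using d exp_of_nat_mult[of 4 "ln (real d)"] by simp
    also have "\<dots> ^ s = exp (real s * (4 * ln (real d)))" by (rule exp_of_nat_mult[symmetric])
    also have "\<dots> \<le> exp Z"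
      unfolding Z_def using mult_right_mono[OF s_S, of "4 * ln (real d)"] lnd by (simp add: mult_ac)
    finally show ?thesis .
  qed
  have r_lower: "real d powr (1 - \<delta>) \<le> real r - 1" unfolding r_def by simp
  have r_upper: "real r \<le> R" unfolding r_def R by (simp add: of_nat_nat) linarith
  have r0: "0 < r" by (simp add: r_def)
  have choose2: "real (n choose 2) = real n * (real n - 1) / 2" for n
  proof (cases n)
    case (Suc j)
    have "even (Suc j * j)" by simp
    then show ?thesis unfolding Suc choose_two by (simp add: real_of_nat_div algebra_simps)
  qed simp

  have exists_E: "\<exists>E\<subseteq>pairs {..<N}. (p - \<delta> * p) * real (N choose 2) \<le> real (card E) \<and>
    (\<forall>W. \<not> clique_of_small_sets N s r E W)"
  proof (rule exists_host)
    show "0 \<le> p" "p \<le> 1" "2 \<le> N" "\<delta> * p \<le> p" using p01 N2 \<delta> by simp_all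
    define q where "q = (1 - p) ^ (s * s)"
    have q01: "0 \<le> q" "q \<le> 1" unfolding q_def using p01(1,2) by (simp_all add: power_le_one)
    \<comment> \<open>\<open>q\<close> bounds from below the probability that two small sets are
      nonadjacent. It equals \<open>exp (- (x * s * s))\<close>, and
      \<open>x * S\<^sup>2 = ln d\<close> turns this into a power of \<open>d\<close>.\<close>
    have q_lower: "real d powr (- ((1 - \<delta>)\<^sup>2)) \<le> q"
    proof -
      have "real s * real s \<le> ((1 - \<delta>) * S) * ((1 - \<delta>) * S)" using s_upper by (intro mult_mono) auto
      then have "x * (real s * real s) \<le> x * (((1 - \<delta>) * S) * ((1 - \<delta>) * S))"
        using x by (intro mult_left_mono) auto
      also have "\<dots> = (1 - \<delta>)\<^sup>2 * (x * S\<^sup>2)" by (simp add: power2_eq_square)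
      finally have le: "x * (real s * real s) \<le> (1 - \<delta>)\<^sup>2 * ln (real d)" unfolding S2 .
      have "q = exp (- (x * (real s * real s)))"
        unfolding q_def p01(3) exp_of_nat_mult[symmetric] by (simp add: mult_ac)
      then show ?thesis using le d by (simp add: powr_def)
    qed
    \<comment> \<open>The exponents \<open>1 - \<delta>\<close> of \<open>r\<close> and
      \<open>- ((1 - \<delta>)\<^sup>2)\<close> of \<open>q\<close> add up to
      \<open>\<delta> * (1 - \<delta>)\<close>, which is positive, so \<open>q * (r - 1)\<close>
      outgrows the entropy term \<open>Z\<close>.\<close>
    have "real d powr (\<delta> * (1 - \<delta>)) = real d powr (- ((1 - \<delta>)\<^sup>2)) * real d powr (1 - \<delta>)"
      unfolding powr_add[symmetric] by (simp add: power2_eq_square algebra_simps)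
    also have "\<dots> \<le> q * (real r - 1)" using q_lower r_lower q01 by (intro mult_mono) auto
    finally have qr: "Z - q * (real r - 1) / 2 < ln (\<delta> * p)" using host unfolding Z_def by linarith
    have \<eta>: "0 < \<delta> * p" "\<delta> * p < 1"
      using \<delta> p01 mult_strict_mono[of \<delta> 1 p 1] by simp_all
    have "real (((N + 1) ^ s) ^ r) * (1 - q) ^ (r choose 2)
      \<le> exp Z ^ r * exp (- (real (r choose 2) * q))"
    proof (rule mult_mono)
      show "real (((N + 1) ^ s) ^ r) \<le> exp Z ^ r"
        unfolding of_nat_power[of "(N + 1) ^ s"] using Z by (intro power_mono) auto
      show "(1 - q) ^ (r choose 2) \<le> exp (- (real (r choose 2) * q))"
        using q01 by (intro one_minus_power_le_exp)
    qed (use q01 in auto)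
    also have "\<dots> = exp (real r * (Z - q * (real r - 1) / 2))"
      unfolding exp_of_nat_mult[symmetric] exp_add[symmetric] choose2 by (simp add: field_simps)
    also have "\<dots> < exp (real r * ln (\<delta> * p))" using qr r0 by simp
    \<comment> \<open>Since \<open>\<delta> * p < 1\<close> the logarithm is negative, and a factor
      \<open>r \<ge> 1\<close> only decreases it.\<close>
    also have "\<dots> \<le> exp (ln (\<delta> * p))"
    proof -
      have "ln (\<delta> * p) \<le> 0" using \<eta> by simp
      then have "real r * ln (\<delta> * p) \<le> 1 * ln (\<delta> * p)" using r0 by (intro mult_right_mono_neg) auto
      then show ?thesis by simp
    qed
    also have "\<dots> = \<delta> * p" using \<eta> by simp
    finally show "real (((N + 1) ^ s) ^ r) * (1 - (1 - p) ^ (s * s)) ^ (r choose 2) < \<delta> * p"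
      unfolding q_def .
  qed
  then obtain E where E: "E \<subseteq> pairs {..<N}" "(p - \<delta> * p) * real (N choose 2) \<le> real (card E)"
    "\<And>W. \<not> clique_of_small_sets N s r E W" by blast
  have N0: "0 < N" and k0': "0 < k" using N2 k0 by simp_all

  have degree: "p * (1 - \<delta>) ^ 4 * real t * S \<le> average_degree (blowup N k E)"
  proof -
    have "p * (1 - \<delta>) ^ 4 * real t * S = (p * (1 - \<delta>)) * ((1 - \<delta>) ^ 3 * real t * S)"
      by (simp add: eval_nat_numeral mult_ac)
    also have "\<dots> \<le> (p * (1 - \<delta>)) * ((real N - 1) * real k)"
      using p01 \<delta> main by (intro mult_left_mono) auto
    also have "\<dots> = 2 * real k * ((p - \<delta> * p) * real (N choose 2)) / real N"
      unfolding choose2 using N0 by (simp add: field_simps)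
    also have "\<dots> \<le> 2 * real k * real (card E) / real N"
      using E(2) by (intro divide_right_mono mult_left_mono) auto
    also have "\<dots> = average_degree (blowup N k E)"
      using average_degree_blowup[OF N0 k0' E(1)] by simp
    finally show ?thesis .
  qed

  \<comment> \<open>Half of the bound \<open>n\<^sup>2 / (16 * r)\<close> with
    \<open>n \<ge> \<delta> * t\<close> and \<open>r \<le> R\<close>; the other half pays for the
    overlaps.\<close>
  define b where "b = (\<delta> * real t)\<^sup>2 / (32 * R)"
  have bad: "b \<le> real (card (nonadjacent_pairs E t W))" if W: "W \<in> configurations N k s t" for W
  proof -
    define n where "n = real (card (live t W))"
    have n_le: "card (live t W) \<le> t" using card_mono[OF _ live_subset[of t W]] by simp
    have n_lower: "\<delta> * real t \<le> n"
    proof -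
      have "(t - card (live t W)) * (s + 1) \<le> N * k" using W by (simp add: configurations_def)
      then have "real (t - card (live t W)) * real (s + 1) \<le> real (N * k)"
        by (simp only: of_nat_mult[symmetric] of_nat_le_iff)
      moreover have "real (t - card (live t W)) = real t - n" using n_le by (simp add: n_def of_nat_diff)
      moreover have "(real t - n) * ((1 - \<delta>) * S) \<le> (real t - n) * real (s + 1)"
        using s_lower n_le by (intro mult_left_mono) (simp_all add: n_def)
      ultimately have "(real t - n) * ((1 - \<delta>) * S) \<le> ((1 - \<delta>) * real t) * ((1 - \<delta>) * S)"
        using Nk by (simp add: power2_eq_square mult_ac)
      moreover have "0 < (1 - \<delta>) * S" using \<delta> S0 by simp
      ultimately have "real t - n \<le> (1 - \<delta>) * real t" by (rule mult_right_le_imp_le)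
      then show ?thesis by (simp add: algebra_simps)
    qed
    have "4 * real r \<le> \<delta> * real d" using r_upper r_small by linarith
    also have "\<dots> \<le> \<delta> * real t" using \<delta> t0 by (intro mult_left_mono) auto
    also note n_lower
    finally have "4 * r \<le> card (live t W)" unfolding n_def by linarith
    from card_nonadjacent_pairs_ge[OF W r0 this E(3)]
    have ge: "n\<^sup>2 / (16 * real r) - n * real (s * (k - 1)) / 2 \<le> real (card (nonadjacent_pairs E t W))"
      unfolding n_def .
    have n0: "0 \<le> n" by (simp add: n_def)
    have "real (s * (k - 1)) \<le> S * (real t / real d ^ 3)"
      unfolding of_nat_mult using s_S k_pred S0 by (intro mult_mono) auto
    also have "\<dots> = real t * (S / real d ^ 3)" by simp
    also have "\<dots> \<le> real t * (\<delta> / (16 * R))" using overlap t0 by (intro mult_left_mono) auto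
    also have "\<dots> = (\<delta> * real t) / (16 * R)" by simp
    also have "\<dots> \<le> n / (16 * R)" using n_lower R0 by (intro divide_right_mono) auto
    also have "\<dots> \<le> n / (16 * real r)" using r_upper r0 n0 by (intro divide_left_mono) auto
    finally have "n * real (s * (k - 1)) \<le> n * (n / (16 * real r))" using n0 by (rule mult_left_mono)
    then have "n\<^sup>2 / (16 * real r) / 2 \<le> n\<^sup>2 / (16 * real r) - n * real (s * (k - 1)) / 2"
      by (simp add: power2_eq_square)
    moreover have "b \<le> n\<^sup>2 / (32 * real r)"
      unfolding b_def using n_lower n0 r0 r_upper \<delta> t0 R0 by (intro frac_le power_mono) auto
    ultimately show ?thesis using ge by simp
  qed

  have "measure_pmf.prob (random_graph t m) {H. is_minor H (blowup N k E)}
      \<le> real (((N + 1) ^ s) ^ t) * exp (- (real m * (b / real (t choose 2))))"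
    using t d by (intro prob_minor_blowup_le[OF N0 k0' _ m(1) bad]) auto
  also have "\<dots> \<le> exp Z ^ t * exp (- (real t * (\<delta>\<^sup>2 * real d / (64 * R))))"
  proof (rule mult_mono)
    show "real (((N + 1) ^ s) ^ t) \<le> exp Z ^ t"
      unfolding of_nat_power[of "(N + 1) ^ s"] using Z by (intro power_mono) auto
    have M: "0 < real (t choose 2)" "real (t choose 2) \<le> (real t)\<^sup>2 / 2"
      using t d by (simp_all add: choose2 power2_eq_square algebra_simps)
    \<comment> \<open>Uses \<open>m \<ge> t * d / 4\<close> and
      \<open>t choose 2 \<le> t\<^sup>2 / 2\<close>; the exponent is linear in \<open>t\<close>,
      like that of the number of configurations.\<close>
    have "real t * (\<delta>\<^sup>2 * real d / (64 * R)) = (real t * real d / 4) * (b / ((real t)\<^sup>2 / 2))"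
      unfolding b_def using t0 R0 by (simp add: power2_eq_square field_simps)
    also have "\<dots> \<le> real m * (b / real (t choose 2))"
    proof (rule mult_mono[OF m(2)])
      show "b / ((real t)\<^sup>2 / 2) \<le> b / real (t choose 2)"
        using M R0 by (intro divide_left_mono) (auto simp: b_def)
      show "0 \<le> b / ((real t)\<^sup>2 / 2)" using R0 by (simp add: b_def)
    qed simp
    finally show "exp (- (real m * (b / real (t choose 2)))) \<le> exp (- (real t * (\<delta>\<^sup>2 * real d / (64 * R))))"
      by simp
  qed auto
  also have "\<dots> = exp (real t * (Z - \<delta>\<^sup>2 * real d / (64 * R)))"
    unfolding exp_of_nat_mult[symmetric] exp_add[symmetric] by (simp add: algebra_simps)
  also have "\<dots> < exp (real t * ln c)" using union t0 unfolding Z_def by simp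
  also have "\<dots> = c ^ t" using c by (simp add: exp_of_nat_mult)
  finally show ?thesis
    using degree simple_graph_blowup[OF N0 k0' E(1)] by blast
qed

theorem theorem4:
  fixes \<epsilon> c :: real
  assumes "0 < \<epsilon>" "\<epsilon> < 1" "0 < c" "c < 1"
  shows "\<exists>d\<^sub>0 :: nat. \<forall>d \<ge> d\<^sub>0. \<forall>t \<ge> d + 1.
    \<forall>m \<in> {nat \<lfloor>real (t * d) / 2\<rfloor>, nat \<lceil>real (t * d) / 2\<rceil>}.
      (\<exists>G :: nat sgraph. simple_graph G \<and>
         average_degree G \<ge> (1 - \<epsilon>) * lambda_const * real t * sqrt (ln (real d)) \<and>
         measure_pmf.prob (random_graph t m) {H. is_minor H G} < c ^ t) \<and>
      measure_pmf.prob (random_graph t m)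
        {H. minor_threshold H \<ge> (1 - \<epsilon>) * lambda_const * real t * sqrt (ln (real d))}
        > 1 - c ^ t"
proof -
  obtain x :: real where x: "0 < x"
    and max: "\<And>y. 0 < y \<Longrightarrow> (1 - exp (- y)) / sqrt y \<le> (1 - exp (- x)) / sqrt x"
    using lambda_max_attained by blast
  have lam: "lambda_const = (1 - exp (- x)) / sqrt x" by (rule lambda_const_eq[OF x max])
  define p where "p = 1 - exp (- x)"
  \<comment> \<open>By Bernoulli's inequality the four factors \<open>1 - \<delta>\<close> cost at
    most \<open>4 * \<delta> = \<epsilon>\<close>.\<close>
  define \<delta> where "\<delta> = \<epsilon> / 4"
  have p0: "0 < p" using x by (simp add: p_def)
  have \<delta>: "0 < \<delta>" "\<delta> < 1" using assms by (simp_all add: \<delta>_def)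
  have \<delta>4: "1 - \<epsilon> \<le> (1 - \<delta>) ^ 4"
    using Bernoulli_inequality[of "- \<delta>" 4] \<delta> by (simp add: \<delta>_def)
  obtain d\<^sub>0 :: nat where d\<^sub>0: "\<And>d. real d\<^sub>0 \<le> d \<Longrightarrow>
    4 / d \<le> \<delta> * (1 - \<delta>)\<^sup>2 * sqrt (ln d / x) \<and> sqrt (ln d / x) * d ^ 3 + 1 \<le> d ^ 4 \<and>
    4 * sqrt (ln d / x) * ln d - d powr (\<delta> * (1 - \<delta>)) / 2 < ln (\<delta> * p) \<and>
    4 * (d powr (1 - \<delta>) + 2) \<le> \<delta> * d \<and>
    sqrt (ln d / x) / d ^ 3 \<le> \<delta> / (16 * (d powr (1 - \<delta>) + 2)) \<and>
    4 * sqrt (ln d / x) * ln d - \<delta>\<^sup>2 * d / (64 * (d powr (1 - \<delta>) + 2)) < ln c \<and> 4 \<le> d"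
  proof -
    obtain D where D: "\<And>d. D \<le> d \<Longrightarrow>
      4 / d \<le> \<delta> * (1 - \<delta>)\<^sup>2 * sqrt (ln d / x) \<and> sqrt (ln d / x) * d ^ 3 + 1 \<le> d ^ 4 \<and>
      4 * sqrt (ln d / x) * ln d - d powr (\<delta> * (1 - \<delta>)) / 2 < ln (\<delta> * p) \<and>
      4 * (d powr (1 - \<delta>) + 2) \<le> \<delta> * d \<and>
      sqrt (ln d / x) / d ^ 3 \<le> \<delta> / (16 * (d powr (1 - \<delta>) + 2)) \<and>
      4 * sqrt (ln d / x) * ln d - \<delta>\<^sup>2 * d / (64 * (d powr (1 - \<delta>) + 2)) < ln c \<and> 4 \<le> d"
      using eventually_parameters[OF x \<delta> p0 assms(3)] unfolding eventually_at_top_linorder by blast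
    have "D \<le> d" if "real (nat \<lceil>D\<rceil>) \<le> d" for d using that by linarith
    then show ?thesis using D by (intro that[of "nat \<lceil>D\<rceil>"]) blast
  qed
  show ?thesis
  proof (intro exI[of _ d\<^sub>0] allI impI ballI)
    fix d t m :: nat
    assume d: "d\<^sub>0 \<le> d" and t: "d + 1 \<le> t"
      and m: "m \<in> {nat \<lfloor>real (t * d) / 2\<rfloor>, nat \<lceil>real (t * d) / 2\<rceil>}"
    let ?D = "(1 - \<epsilon>) * lambda_const * real t * sqrt (ln (real d))"
    let ?P = "measure_pmf.prob (random_graph t m)"
    have cond: "real d\<^sub>0 \<le> real d" using d by simp
    note par = d\<^sub>0[OF cond]
    have d4: "4 \<le> real d" using par by blast
    have lnd: "0 \<le> ln (real d)" using d4 by simp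
    have choose2: "t choose 2 = t * (t - 1) div 2" by (rule choose_two)
    \<comment> \<open>\<open>t * d / 2\<close> is at most the integer \<open>t choose 2\<close>, so
      rounding up stays below it as well and the probability space is nonempty.\<close>
    have m_upper: "m \<le> t choose 2"
    proof -
      have "t * d \<le> t * (t - 1)" using t by (intro mult_left_mono) auto
      moreover have "even (t * (t - 1))" by (cases t) auto
      ultimately have "t * d \<le> 2 * (t choose 2)" unfolding choose2 by simp
      then have "real (t * d) \<le> real (2 * (t choose 2))" by (simp only: of_nat_le_iff)
      then have "real (t * d) / 2 \<le> of_int (int (t choose 2))" by simp
      then have "\<lceil>real (t * d) / 2\<rceil> \<le> int (t choose 2)" by (simp only: ceiling_le_iff)
      moreover have "\<lfloor>real (t * d) / 2\<rfloor> \<le> \<lceil>real (t * d) / 2\<rceil>" by (rule floor_le_ceiling)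
      ultimately have "nat \<lfloor>real (t * d) / 2\<rfloor> \<le> t choose 2" "nat \<lceil>real (t * d) / 2\<rceil> \<le> t choose 2"
        unfolding nat_le_iff by linarith+
      then show ?thesis using m by blast
    qed
    \<comment> \<open>Rounding loses at most 1, which is at most \<open>t * d / 4\<close>.\<close>
    have m_lower: "real t * real d / 4 \<le> real m"
    proof -
      have "1 * 4 \<le> real t * real d" using t d4 by (intro mult_mono) auto
      moreover have "real (t * d) / 2 - 1 \<le> real m" using m by auto linarith+
      ultimately show ?thesis by simp
    qed
    have "\<exists>G :: nat sgraph. simple_graph G \<and>
        p * (1 - \<delta>) ^ 4 * real t * sqrt (ln (real d) / x) \<le> average_degree G \<and>
        ?P {H. is_minor H G} < c ^ t"
      by (rule exists_blowup[OF x \<delta> p_def assms(3) refl refl]) (use par t m_upper m_lower in auto)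
    then obtain G :: "nat sgraph" where G: "simple_graph G"
      "p * (1 - \<delta>) ^ 4 * real t * sqrt (ln (real d) / x) \<le> average_degree G"
      "?P {H. is_minor H G} < c ^ t" by blast
    \<comment> \<open>This is where the constant arises: \<open>p * sqrt (ln d / x)\<close> equals
      \<open>lambda_const * sqrt (ln d)\<close> for the maximiser \<open>x\<close>.\<close>
    have "?D = (1 - \<epsilon>) * (p * real t * sqrt (ln (real d) / x))"
      unfolding lam p_def real_sqrt_divide by simp
    also have "\<dots> \<le> (1 - \<delta>) ^ 4 * (p * real t * sqrt (ln (real d) / x))"
      using \<delta>4 p0 lnd x by (intro mult_right_mono) auto
    also have "\<dots> = p * (1 - \<delta>) ^ 4 * real t * sqrt (ln (real d) / x)" by (simp add: mult_ac)
    also note G(2)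
    finally have deg: "?D \<le> average_degree G" .
    have "1 - c ^ t < 1 - ?P {H. is_minor H G}" using G(3) by simp
    also have "\<dots> = ?P (- {H. is_minor H G})"
      using measure_pmf.prob_compl[of "{H. is_minor H G}" "random_graph t m"] by (simp add: Compl_eq_Diff_UNIV)
    \<comment> \<open>On the support \<open>H\<close> is a simple graph, so a host without
      \<open>H\<close> as a minor bounds the threshold from below.\<close>
    also have "\<dots> = ?P (- {H. is_minor H G} \<inter> set_pmf (random_graph t m))"
      by (rule measure_Int_set_pmf[symmetric])
    also have "\<dots> \<le> ?P {H. ?D \<le> minor_threshold H}"
    proof (rule measure_pmf.finite_measure_mono)
      have "set_pmf (random_graph t m) = graphs_with_edges t m"
        using t m_upper by (intro set_pmf_random_graph) auto
      then show "- {H. is_minor H G} \<inter> set_pmf (random_graph t m) \<subseteq> {H. ?D \<le> minor_threshold H}"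
        using minor_threshold_ge[OF _ G(1) _ deg] by (auto simp: graphs_with_edges_def)
    qed simp
    finally show "(\<exists>G :: nat sgraph. simple_graph G \<and> ?D \<le> average_degree G \<and>
        ?P {H. is_minor H G} < c ^ t) \<and> 1 - c ^ t < ?P {H. ?D \<le> minor_threshold H}"
      using G(1,3) deg by blast
  qed
qed

end
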